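(* Let $\Omega=(0,\ell)\times D'\subset\mathbb{R}^n$, where $D'\subset\mathbb{R}^{n-1}$ is a bounded domain with smooth boundary, and write $x=(x_1,x')$. Let $\beta\in(0,1)$ be a constant, and let $u$ satisfy $$\begin{cases}\partial_tu(x,t)+\mathcal D\mathcal D^*u(x,t)=f(x',t), & x\in\Omega,\ t>0,\\ u(x,0)=0, & x\in\mathbb{R}^n,\\ \mathcal N(\mathcal D^*u)(x,t)=0, & x\in\mathbb{R}^n\setminus\Omega,\ t>0,\end{cases}$$ with a source $f$ independent of $x_1$. Assume that $u,\partial_{x_1}u\in C(0,T;H^{\beta}_c(\mathbb{R}^n))\cap H^1(0,T;L^2(\Omega))$. Let $0<t_0\le T$. If $u=0$ on $(\mathbb{R}^n\setminus\Omega)\times(0,t_0)$, then $f(x',t)=0$ for $x'\in D'$, $0\le t\le t_0$.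
   Context: Here the nonlocal operators have constant order $\beta$, infinite horizon (so the interaction domain is $\Omega_{\mathcal I}=\mathbb{R}^n\setminus\Omega$ and $\tilde\Omega=\Omega\cup\Omega_{\mathcal I}=\mathbb{R}^n$) and identity coefficient: with $\alpha(x,y)=\frac{y-x}{|y-x|^{n/2+\beta+1}}$ and $\mathcal D^*u(x,y)=-(u(y)-u(x))\alpha(x,y)$, $$\mathcal D\mathcal D^*u(x)=-2\int_{\mathbb{R}^n}\frac{u(y)-u(x)}{|y-x|^{n+2\beta}}dy,\qquad \mathcal N(\mathcal D^*u)(x)=2\int_{\mathbb{R}^n}\frac{u(y)-u(x)}{|y-x|^{n+2\beta}}dy\quad(x\in\mathbb{R}^n\setminus\Omega).$$ $H^\beta_c(\mathbb{R}^n)$ is the set of $u\in L^2(\mathbb{R}^n)$ with $\int_{\mathbb{R}^n}\int_{\mathbb{R}^n}\frac{(u(y)-u(x))^2}{|y-x|^{n+2\beta}}dydx<\infty$ and satisfying the Neumann-type volume constraint $\int_{\mathbb{R}^n}u\,dx=0$. $C(0,T;X)$ is the space of continuous functions of $t\in[0,T]$ with values in $X$. *)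

theory Defs
  imports "HOL-Analysis.Analysis"
begin

section \<open>Smooth functions, test functions, smooth domains\<close>

text \<open>Only meant for open sets; higher derivatives are iterated partial derivatives.\<close>

primrec Ck_on :: "nat \<Rightarrow> 'a::euclidean_space set \<Rightarrow> ('a \<Rightarrow> real) \<Rightarrow> bool" where
  "Ck_on 0 S f \<longleftrightarrow> continuous_on S f"
| "Ck_on (Suc k) S f \<longleftrightarrow>
     f differentiable_on S \<and> (\<forall>i\<in>Basis. Ck_on k S (\<lambda>x. frechet_derivative f (at x) i))"

definition smooth_on :: "'a::euclidean_space set \<Rightarrow> ('a \<Rightarrow> real) \<Rightarrow> bool" where
  "smooth_on S f \<longleftrightarrow> (\<forall>k. Ck_on k S f)"

definition test_function :: "'a::euclidean_space set \<Rightarrow> ('a \<Rightarrow> real) \<Rightarrow> bool" where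
  "test_function S \<phi> \<longleftrightarrow>
     smooth_on UNIV \<phi> \<and> compact (closure {x. \<phi> x \<noteq> 0}) \<and> closure {x. \<phi> x \<noteq> 0} \<subseteq> S"

text \<open>
  Smoothness of the boundary is expressed by local defining functions with nonvanishing
  differential. Unlike the description of the boundary as a local graph, this also makes sense
  verbatim in dimension one, where the bounded smooth domains are the bounded open intervals.
\<close>

definition smooth_bounded_domain :: "'a::euclidean_space set \<Rightarrow> bool" where
  "smooth_bounded_domain D \<longleftrightarrow>
     D \<noteq> {} \<and> open D \<and> connected D \<and> bounded D \<and>
     (\<forall>p\<in>frontier D. \<exists>U \<rho>. open U \<and> p \<in> U \<and> smooth_on U \<rho> \<and>
        (\<forall>x\<in>U. frechet_derivative \<rho> (at x) \<noteq> (\<lambda>_. 0)) \<and>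
        D \<inter> U = {x \<in> U. \<rho> x < 0})"

section \<open>Nonlocal operators\<close>

definition nl_alpha :: "real \<Rightarrow> 'a::euclidean_space \<Rightarrow> 'a \<Rightarrow> 'a" where
  "nl_alpha \<beta> x y = (y - x) /\<^sub>R (norm (y - x) powr (real DIM('a) / 2 + \<beta> + 1))"

definition nl_Dstar :: "real \<Rightarrow> ('a::euclidean_space \<Rightarrow> real) \<Rightarrow> 'a \<Rightarrow> 'a \<Rightarrow> 'a" where
  "nl_Dstar \<beta> u x y = - (u y - u x) *\<^sub>R nl_alpha \<beta> x y"

definition nl_quotient :: "real \<Rightarrow> ('a::euclidean_space \<Rightarrow> real) \<Rightarrow> 'a \<Rightarrow> 'a \<Rightarrow> real" where
  "nl_quotient \<beta> u x y = (u y - u x) / norm (y - x) powr (real DIM('a) + 2 * \<beta>)"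

lemma nl_Dstar_inner_alpha:
  fixes x y :: "'a::euclidean_space"
  shows "nl_Dstar \<beta> u x y \<bullet> nl_alpha \<beta> x y = - nl_quotient \<beta> u x y"
proof (cases "x = y")
  case True
  then show ?thesis by (simp add: nl_Dstar_def nl_alpha_def nl_quotient_def)
next
  case False
  define r where "r = norm (y - x)"
  have r: "r > 0" using False by (simp add: r_def)
  define s where "s = real DIM('a) / 2 + \<beta> + 1"
  have "r powr s * r powr s = r powr (s + s)" by (rule powr_add[symmetric])
  also have "s + s = (real DIM('a) + 2 * \<beta>) + 2" by (simp add: s_def)
  also have "r powr \<dots> = r powr (real DIM('a) + 2 * \<beta>) * r\<^sup>2"
    using r by (simp add: powr_add flip: powr_numeral)
  finally have eq: "r powr s * r powr s = r powr (real DIM('a) + 2 * \<beta>) * r\<^sup>2" .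
  have "nl_alpha \<beta> x y \<bullet> nl_alpha \<beta> x y = r\<^sup>2 / (r powr s * r powr s)"
    by (simp add: nl_alpha_def r_def s_def dot_square_norm power2_eq_square divide_simps)
  also have "\<dots> = 1 / r powr (real DIM('a) + 2 * \<beta>)"
    unfolding eq using r by simp
  finally show ?thesis
    by (simp add: nl_Dstar_def nl_quotient_def r_def algebra_simps diff_divide_distrib)
qed

text \<open>
  For \<open>\<beta> \<ge> 1/2\<close> the singular integrals need not converge absolutely, so they are read as principal
  values; where the integrand is integrable, this is the Lebesgue integral. The operators are
  relations, so that asserting a value includes asserting that the principal value exists.
\<close>

definition has_pv_integral :: "('a::euclidean_space \<Rightarrow> real) \<Rightarrow> 'a \<Rightarrow> real \<Rightarrow> bool" where
  "has_pv_integral g x I \<longleftrightarrow>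
     (\<forall>e>0. set_integrable lebesgue (- ball x e) g) \<and>
     ((\<lambda>e. LINT y:- ball x e|lebesgue. g y) \<longlongrightarrow> I) (at_right 0)"

definition has_DDstar :: "real \<Rightarrow> ('a::euclidean_space \<Rightarrow> real) \<Rightarrow> 'a \<Rightarrow> real \<Rightarrow> bool" where
  "has_DDstar \<beta> u x q \<longleftrightarrow> (\<exists>I. has_pv_integral (nl_quotient \<beta> u x) x I \<and> q = - 2 * I)"

definition has_NDstar :: "real \<Rightarrow> ('a::euclidean_space \<Rightarrow> real) \<Rightarrow> 'a \<Rightarrow> real \<Rightarrow> bool" where
  "has_NDstar \<beta> u x q \<longleftrightarrow> (\<exists>I. has_pv_integral (nl_quotient \<beta> u x) x I \<and> q = 2 * I)"

section \<open>Function spaces\<close>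

definition L2_sqnorm :: "('a::euclidean_space \<Rightarrow> real) \<Rightarrow> ennreal" where
  "L2_sqnorm u = (\<integral>\<^sup>+x. ennreal ((u x)\<^sup>2) \<partial>lebesgue)"

definition gagliardo :: "real \<Rightarrow> ('a::euclidean_space \<Rightarrow> real) \<Rightarrow> ennreal" where
  "gagliardo \<beta> u =
     (\<integral>\<^sup>+x. (\<integral>\<^sup>+y. ennreal ((u y - u x)\<^sup>2 / norm (y - x) powr (real DIM('a) + 2 * \<beta>)) \<partial>lebesgue)
       \<partial>lebesgue)"

text \<open>
  The mean-zero constraint includes integrability, since a square-integrable function on the whole
  space need not have an integral.
\<close>

definition Hbc :: "real \<Rightarrow> ('a::euclidean_space \<Rightarrow> real) set" where
  "Hbc \<beta> = {u. u \<in> borel_measurable lebesgue \<and> L2_sqnorm u < \<infinity> \<and> gagliardo \<beta> u < \<infinity> \<and>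
                has_bochner_integral lebesgue u 0}"

text \<open>Functions of space and time are curves in a space of functions: \<open>u t\<close> is the state at \<open>t\<close>.\<close>

definition C_Hbc :: "real \<Rightarrow> real \<Rightarrow> (real \<Rightarrow> 'a::euclidean_space \<Rightarrow> real) \<Rightarrow> bool" where
  "C_Hbc \<beta> T u \<longleftrightarrow>
     (\<forall>t\<in>{0..T}. u t \<in> Hbc \<beta>) \<and>
     (\<forall>t\<in>{0..T}. ((\<lambda>s. L2_sqnorm (\<lambda>x. u s x - u t x) + gagliardo \<beta> (\<lambda>x. u s x - u t x)) \<longlongrightarrow> 0)
        (at t within {0..T}))"

text \<open>
  \<open>L\<^sup>2(0,T;L\<^sup>2(\<Omega>))\<close> is identified with \<open>L\<^sup>2((0,T) \<times> \<Omega>)\<close>; under this identification the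
  \<open>L\<^sup>2(\<Omega>)\<close>-valued integrals against scalar test functions of time that define the weak time
  derivative are computed pointwise almost everywhere.
\<close>

definition L2_time_space ::
  "real \<Rightarrow> 'a::euclidean_space set \<Rightarrow> (real \<Rightarrow> 'a \<Rightarrow> real) \<Rightarrow> bool" where
  "L2_time_space T \<Omega> u \<longleftrightarrow>
     (\<lambda>(t, x). u t x) \<in> borel_measurable (lebesgue_on ({0<..<T} \<times> \<Omega>)) \<and>
     (\<integral>\<^sup>+(t, x). ennreal ((u t x)\<^sup>2) \<partial>lebesgue_on ({0<..<T} \<times> \<Omega>)) < \<infinity>"

definition has_weak_time_derivative ::
  "real \<Rightarrow> 'a::euclidean_space set \<Rightarrow> (real \<Rightarrow> 'a \<Rightarrow> real) \<Rightarrow> (real \<Rightarrow> 'a \<Rightarrow> real) \<Rightarrow> bool" where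
  "has_weak_time_derivative T \<Omega> u w \<longleftrightarrow>
     (\<forall>\<phi>. test_function {0<..<T} \<phi> \<longrightarrow>
        (AE x in lebesgue. x \<in> \<Omega> \<longrightarrow>
           (LINT t:{0<..<T}|lebesgue. u t x * deriv \<phi> t) =
           - (LINT t:{0<..<T}|lebesgue. w t x * \<phi> t)))"

definition H1_L2 :: "real \<Rightarrow> 'a::euclidean_space set \<Rightarrow> (real \<Rightarrow> 'a \<Rightarrow> real) \<Rightarrow> bool" where
  "H1_L2 T \<Omega> u \<longleftrightarrow>
     L2_time_space T \<Omega> u \<and> (\<exists>w. L2_time_space T \<Omega> w \<and> has_weak_time_derivative T \<Omega> u w)"

definition has_weak_derivative_along ::
  "'a::euclidean_space \<Rightarrow> ('a \<Rightarrow> real) \<Rightarrow> ('a \<Rightarrow> real) \<Rightarrow> bool" where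
  "has_weak_derivative_along e u v \<longleftrightarrow>
     (\<forall>\<phi>. test_function UNIV \<phi> \<longrightarrow>
        (LINT x|lebesgue. u x * frechet_derivative \<phi> (at x) e) = - (LINT x|lebesgue. v x * \<phi> x))"

end

theory Submission
  imports Defs
begin

text \<open>
  For almost every \<open>t < t0\<close> the state \<open>v = u t\<close> vanishes outside the bounded set \<open>\<Omega>\<close>, so there the Neumann
  condition says that the potential \<open>\<integral> v(y) |y - x|\<^sup>-\<^sup>s dy\<close>, \<open>s = n + 2\<beta>\<close>, vanishes. Applying powers of
  the Laplacian in \<open>x\<close> replaces \<open>s\<close> by \<open>s + 2k\<close> for every \<open>k\<close>, whence by Weierstrass
  \<open>\<integral> v(y) exp(- c |y - x|\<^sup>2) dy = 0\<close> for \<open>c \<ge> 0\<close> and \<open>x\<close> in a ball away from \<open>\<Omega>\<close>. The span of these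
  Gaussians is an algebra separating points, and Stone-Weierstrass gives \<open>v = 0\<close>. So \<open>u\<close> vanishes
  on \<open>(0, t0)\<close>, hence so do its weak time derivative and the nonlocal term, and therefore \<open>f\<close>.
\<close>

section \<open>Functions orthogonal to an algebra of continuous functions\<close>

text \<open>The Laplacian sends the power -s of the distance to s (s + 2 - n) times the power -s -
  2. Since s = n + 2 \<beta>, neither this factor nor a later one vanishes; at the Newtonian
  exponent s = n - 2 the descent would stop at once. For one centre the descent only tests
  \<open>v\<close> against functions of the distance to it; moving the centre through a ball is what
  separates points. Principal values disappear because the centres stay away from the support of
  \<open>v\<close>. The other obstacle is that every hypothesis on the equation holds only almost
  everywhere. The null set in the weak time derivative depends on the test function, so a countable
  family has to suffice: monomials in \<open>t\<close> with smooth cut-offs. Exchanging "almost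
  every t" with "almost every x" needs joint measurability, which \<open>L2_time_space\<close>
  provides on the cylinder over \<Omega>. Since \<open>f\<close> is independent of the first
  coordinate, a single good value of that coordinate yields the conclusion on
  \<open>D'\<close>.\<close>

lemma integrable_mult_continuous_lebesgue_on:
  fixes v g :: "'a::euclidean_space \<Rightarrow> real"
  assumes K: "compact K" and v: "integrable (lebesgue_on K) v" and g: "continuous_on K g"
  shows "integrable (lebesgue_on K) (\<lambda>y. v y * g y)"
proof -
  have KL: "K \<in> sets lebesgue" using K by (simp add: borel_compact)
  obtain B where B: "\<And>y. y \<in> K \<Longrightarrow> \<bar>g y\<bar> \<le> B"
    using compact_imp_bounded[OF compact_continuous_image[OF g K]]
    by (auto simp: bounded_iff)
  have gm: "g \<in> borel_measurable (lebesgue_on K)"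
    using continuous_imp_measurable_on_sets_lebesgue[OF g KL] .
  show ?thesis
  proof (rule Bochner_Integration.integrable_bound)
    show "integrable (lebesgue_on K) (\<lambda>y. B * \<bar>v y\<bar>)"
      using v by auto
    show "(\<lambda>y. v y * g y) \<in> borel_measurable (lebesgue_on K)"
      using v gm by measurable
    show "AE y in lebesgue_on K. norm (v y * g y) \<le> norm (B * \<bar>v y\<bar>)"
    proof (rule AE_I2)
      fix y assume "y \<in> space (lebesgue_on K)"
      then have b: "\<bar>g y\<bar> \<le> B" using B by simp
      have "\<bar>v y\<bar> * \<bar>g y\<bar> \<le> \<bar>v y\<bar> * \<bar>B\<bar>"
        using b by (intro mult_left_mono) auto
      then show "norm (v y * g y) \<le> norm (B * \<bar>v y\<bar>)"
        by (simp add: abs_mult mult.commute)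
    qed
  qed
qed

text \<open>Pairing with an integrable \<open>v\<close> is continuous for the sup norm, so its
  kernel is uniformly closed. All passages to the limit from polynomials, from a function ring and
  from nearby centres use this.\<close>

lemma integral_zero_uniform_closure:
  fixes v g :: "'a::euclidean_space \<Rightarrow> real"
  assumes K: "compact K" and v: "integrable (lebesgue_on K) v" and g: "continuous_on K g"
    and ap: "\<And>e. e > 0 \<Longrightarrow> \<exists>h. continuous_on K h \<and> (\<integral>y. v y * h y \<partial>lebesgue_on K) = 0 \<and>
              (\<forall>y\<in>K. \<bar>g y - h y\<bar> < e)"
  shows "(\<integral>y. v y * g y \<partial>lebesgue_on K) = 0"
proof -
  define C where "C = (\<integral>y. \<bar>v y\<bar> \<partial>lebesgue_on K)"
  have C: "C \<ge> 0" unfolding C_def by (rule integral_nonneg_AE) auto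
  have le: "\<bar>\<integral>y. v y * g y \<partial>lebesgue_on K\<bar> \<le> e * C" if e: "e > 0" for e
  proof -
    obtain h where h: "continuous_on K h" "(\<integral>y. v y * h y \<partial>lebesgue_on K) = 0"
      "\<And>y. y \<in> K \<Longrightarrow> \<bar>g y - h y\<bar> < e" using ap[OF e] by blast
    have "(\<integral>y. v y * g y \<partial>lebesgue_on K) =
        (\<integral>y. v y * g y \<partial>lebesgue_on K) - (\<integral>y. v y * h y \<partial>lebesgue_on K)"
      using h by simp
    also have "\<dots> = (\<integral>y. v y * g y - v y * h y \<partial>lebesgue_on K)"
      by (rule Bochner_Integration.integral_diff[symmetric])
        (use integrable_mult_continuous_lebesgue_on[OF K v] g h in auto)
    finally have "\<bar>\<integral>y. v y * g y \<partial>lebesgue_on K\<bar> = \<bar>\<integral>y. v y * g y - v y * h y \<partial>lebesgue_on K\<bar>"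
      by simp
    also have "\<dots> \<le> (\<integral>y. \<bar>v y * g y - v y * h y\<bar> \<partial>lebesgue_on K)"
      using integral_norm_bound[of "lebesgue_on K" "\<lambda>y. v y * g y - v y * h y"] by simp
    also have "\<dots> \<le> (\<integral>y. e * \<bar>v y\<bar> \<partial>lebesgue_on K)"
    proof (rule integral_mono)
      show "integrable (lebesgue_on K) (\<lambda>y. \<bar>v y * g y - v y * h y\<bar>)"
        using integrable_mult_continuous_lebesgue_on[OF K v] g h by auto
      show "integrable (lebesgue_on K) (\<lambda>y. e * \<bar>v y\<bar>)" using v by auto
      fix y assume "y \<in> space (lebesgue_on K)"
      then have "\<bar>v y\<bar> * \<bar>g y - h y\<bar> \<le> \<bar>v y\<bar> * e"
        using h(3)[of y] by (intro mult_left_mono) auto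
      then show "\<bar>v y * g y - v y * h y\<bar> \<le> e * \<bar>v y\<bar>"
        by (simp add: abs_mult[symmetric] right_diff_distrib mult.commute)
    qed
    also have "\<dots> = e * C" by (simp add: C_def)
    finally show ?thesis .
  qed
  have "\<bar>\<integral>y. v y * g y \<partial>lebesgue_on K\<bar> \<le> 0 + d" if d: "d > 0" for d
  proof -
    \<comment> \<open>Dividing by C + 1 instead of C covers the case C = 0.\<close>
    have "\<bar>\<integral>y. v y * g y \<partial>lebesgue_on K\<bar> \<le> d / (C + 1) * C"
      using le[of "d / (C + 1)"] d C by simp
    also have "\<dots> \<le> d" using C d by (simp add: field_simps)
    finally show ?thesis by simp
  qed
  then show ?thesis using field_le_epsilon[of "\<bar>\<integral>y. v y * g y \<partial>lebesgue_on K\<bar>" 0] by simp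
qed

text \<open>The right thing to test against is the sign of \<open>v\<close>, since this gives the
  integral of \<open>\<bar>v y\<bar>\<close>. It is not continuous, but it is an almost everywhere
  limit of continuous functions.\<close>

lemma AE_zero_if_orthogonal_continuous:
  fixes v :: "'a::euclidean_space \<Rightarrow> real"
  assumes K: "compact K" and v: "integrable (lebesgue_on K) v"
    and orth: "\<And>g. continuous_on K g \<Longrightarrow> (\<integral>y. v y * g y \<partial>lebesgue_on K) = 0"
  shows "AE y in lebesgue_on K. v y = 0"
proof -
  have KL: "K \<in> sets lebesgue" using K by (simp add: borel_compact)
  define w where "w = (\<lambda>y. if y \<in> K then sgn (v y) else 0)"
  have "(\<lambda>y. sgn (v y)) \<in> borel_measurable (lebesgue_on K)"
    using v by measurable
  then have "w \<in> borel_measurable lebesgue"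
    unfolding w_def by (rule borel_measurable_if_I) (rule KL)
  then have "w measurable_on UNIV"
    by (rule lebesgue_measurable_imp_measurable_on_real) simp
  then obtain N g where N: "negligible N" and g: "\<And>n. continuous_on UNIV (g n)"
    and lim: "\<And>x. x \<notin> N \<Longrightarrow> (\<lambda>n::nat. g n x) \<longlonglongrightarrow> w x"
    unfolding measurable_on_def by auto
  \<comment> \<open>Clipping to [-1, 1] leaves the limit \<open>w\<close> unchanged, because signs
    lie there, and makes \<open>\<bar>v y\<bar>\<close> a majorant.\<close>
  define h where "h n y = max (-1) (min 1 (g n y))" for n y
  have hc: "continuous_on K (h n)" for n
    unfolding h_def by (intro continuous_intros continuous_on_subset[OF g]) auto
  have "(\<lambda>n. \<integral>y. v y * h n y \<partial>lebesgue_on K) \<longlonglongrightarrow> (\<integral>y. v y * w y \<partial>lebesgue_on K)"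
  proof (rule integral_dominated_convergence)
    show "integrable (lebesgue_on K) (\<lambda>y. \<bar>v y\<bar>)" using v by auto
    have "w \<in> borel_measurable (lebesgue_on K)"
      using \<open>w \<in> borel_measurable lebesgue\<close> by (rule measurable_restrict_space1)
    then show "(\<lambda>y. v y * w y) \<in> borel_measurable (lebesgue_on K)" using v by measurable
    show "(\<lambda>y. v y * h n y) \<in> borel_measurable (lebesgue_on K)" for n
      using integrable_mult_continuous_lebesgue_on[OF K v hc] by auto
    have "AE y in lebesgue. y \<notin> N"
      using N by (simp add: AE_not_in negligible_iff_null_sets)
    then have "AE y in lebesgue. (\<lambda>n. v y * h n y) \<longlonglongrightarrow> v y * w y"
    proof (rule AE_mp, intro AE_I2 impI)
      fix y assume "y \<notin> N"
      have "(\<lambda>n. v y * h n y) \<longlonglongrightarrow> v y * max (-1) (min 1 (w y))"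
        unfolding h_def by (intro tendsto_intros lim \<open>y \<notin> N\<close>)
      also have "max (-1) (min 1 (w y)) = w y" by (auto simp: w_def sgn_if)
      finally show "(\<lambda>n. v y * h n y) \<longlonglongrightarrow> v y * w y" .
    qed
    then show "AE y in lebesgue_on K. (\<lambda>n. v y * h n y) \<longlonglongrightarrow> v y * w y"
      using KL by (subst AE_restrict_space_iff) auto
    have "\<bar>h n y\<bar> \<le> 1" for n y by (auto simp: h_def)
    then show "AE y in lebesgue_on K. norm (v y * h n y) \<le> \<bar>v y\<bar>" for n
      by (auto simp: abs_mult intro!: AE_I2 mult_right_le_one_le)
  qed
  moreover have "(\<integral>y. v y * h n y \<partial>lebesgue_on K) = 0" for n by (rule orth[OF hc])
  ultimately have "(\<integral>y. v y * w y \<partial>lebesgue_on K) = 0"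
    by (simp add: LIMSEQ_const_iff)
  also have "(\<integral>y. v y * w y \<partial>lebesgue_on K) = (\<integral>y. \<bar>v y\<bar> \<partial>lebesgue_on K)"
    by (intro Bochner_Integration.integral_cong) (auto simp: w_def abs_sgn)
  finally show ?thesis
    using integral_nonneg_eq_0_iff_AE[of "lebesgue_on K" "\<lambda>y. \<bar>v y\<bar>"] v by auto
qed

lemma AE_zero_if_orthogonal_ring:
  fixes v :: "'a::euclidean_space \<Rightarrow> real"
  assumes R: "function_ring_on R K" and v: "integrable (lebesgue_on K) v"
    and orth: "\<And>g. g \<in> R \<Longrightarrow> (\<integral>y. v y * g y \<partial>lebesgue_on K) = 0"
  shows "AE y in lebesgue_on K. v y = 0"
proof -
  interpret function_ring_on R K by (rule R)
  show ?thesis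
  proof (rule AE_zero_if_orthogonal_continuous[OF compact v])
    fix g :: "'a \<Rightarrow> real" assume g: "continuous_on K g"
    show "(\<integral>y. v y * g y \<partial>lebesgue_on K) = 0"
      using Stone_Weierstrass_basic[OF g]
      by (intro integral_zero_uniform_closure[OF compact v g])
        (metis orth continuous)
  qed
qed

text \<open>Differentiation under the integral sign, reduced to the propagation of zeros: each
  difference quotient integrates to 0, and dominated convergence passes this on to
  \<open>h x\<close>. The majorant comes from compactness of a segment through x times
  \<open>K\<close>.\<close>

lemma integral_parameter_derivative_zero:
  fixes v :: "'a::euclidean_space \<Rightarrow> real" and g h :: "'b::euclidean_space \<Rightarrow> 'a \<Rightarrow> real"
  assumes K: "compact K" and v: "integrable (lebesgue_on K) v" and U: "open U" "x \<in> U"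
    and zero: "\<And>z. z \<in> U \<Longrightarrow> (\<integral>y. v y * g z y \<partial>lebesgue_on K) = 0"
    and gc: "\<And>z. z \<in> U \<Longrightarrow> continuous_on K (g z)"
    and hc: "continuous_on (U \<times> K) (\<lambda>(z, y). h z y)"
    and deriv: "\<And>z y. z \<in> U \<Longrightarrow> y \<in> K \<Longrightarrow>
        ((\<lambda>t. g (z + t *\<^sub>R e) y) has_real_derivative h z y) (at 0)"
  shows "(\<integral>y. v y * h x y \<partial>lebesgue_on K) = 0"
proof -
  obtain r where r: "r > 0" "cball x r \<subseteq> U" using U open_contains_cball by blast
  \<comment> \<open>This keeps \<open>x + t *\<^sub>R e\<close> in the closed ball of radius r for
    all |t| up to d; the summand 1 allows e = 0.\<close>
  define d where "d = r / (norm e + 1)"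
  have d: "d > 0" using r by (simp add: d_def add_nonneg_pos)
  have inU: "x + t *\<^sub>R e \<in> U" if "\<bar>t\<bar> \<le> d" for t
  proof -
    have "\<bar>t\<bar> * norm e \<le> d * (norm e + 1)"
      by (rule mult_mono) (use that d in auto)
    also have "\<dots> = r" by (simp add: d_def add_nonneg_eq_0_iff) 
    finally show ?thesis using r by (auto simp: dist_norm)
  qed
  have "compact ((\<lambda>t. x + t *\<^sub>R e) ` {-d..d} \<times> K)"
    by (intro compact_Times K compact_continuous_image continuous_intros) auto
  moreover have "continuous_on ((\<lambda>t. x + t *\<^sub>R e) ` {-d..d} \<times> K) (\<lambda>(z, y). h z y)"
    by (rule continuous_on_subset[OF hc]) (use inU in auto)
  ultimately have "bounded ((\<lambda>(z, y). h z y) ` ((\<lambda>t. x + t *\<^sub>R e) ` {-d..d} \<times> K))"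
    using compact_continuous_image compact_imp_bounded by blast
  then obtain B where B: "\<And>t y. \<bar>t\<bar> \<le> d \<Longrightarrow> y \<in> K \<Longrightarrow> \<bar>h (x + t *\<^sub>R e) y\<bar> \<le> B"
    by (force simp: bounded_iff)
  have der: "((\<lambda>t. g (x + t *\<^sub>R e) y) has_real_derivative h (x + t *\<^sub>R e) y) (at t)"
    if "\<bar>t\<bar> \<le> d" "y \<in> K" for t y
  proof -
    have "((\<lambda>s. g (x + t *\<^sub>R e + s *\<^sub>R e) y) has_real_derivative h (x + t *\<^sub>R e) y) (at (t - t))"
      using deriv[OF inU[OF that(1)] that(2)] by simp
    then have "((\<lambda>s. g (x + t *\<^sub>R e + (s - t) *\<^sub>R e) y) has_real_derivative h (x + t *\<^sub>R e) y * 1) (at t)"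
      by (rule DERIV_chain2) (auto intro!: derivative_eq_intros)
    then show ?thesis by (simp add: scaleR_diff_left)
  qed
  define q where "q n y = (g (x + (d / Suc n) *\<^sub>R e) y - g x y) / (d / Suc n)" for n :: nat and y
  have tn: "0 < d / Suc n" "d / Suc n \<le> d" for n :: nat
    using d by (auto simp: field_simps)
  have qc: "continuous_on K (q n)" for n
    unfolding q_def using inU[of "d / Suc n"] inU[of 0] tn[of n] d
    by (intro continuous_intros gc) auto
  have hx: "continuous_on K (h x)"
  proof -
    have "continuous_on K ((\<lambda>(z, y). h z y) \<circ> (\<lambda>y. (x, y)))"
      by (intro continuous_on_compose continuous_intros continuous_on_subset[OF hc]) (use U in auto)
    then show ?thesis by (simp add: o_def)
  qed
  have "(\<lambda>n. \<integral>y. v y * q n y \<partial>lebesgue_on K) \<longlonglongrightarrow> (\<integral>y. v y * h x y \<partial>lebesgue_on K)"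
  proof (rule integral_dominated_convergence)
    show "integrable (lebesgue_on K) (\<lambda>y. B * \<bar>v y\<bar>)" using v by auto
    show "(\<lambda>y. v y * h x y) \<in> borel_measurable (lebesgue_on K)"
      using integrable_mult_continuous_lebesgue_on[OF K v hx] by auto
    show "(\<lambda>y. v y * q n y) \<in> borel_measurable (lebesgue_on K)" for n
      using integrable_mult_continuous_lebesgue_on[OF K v qc] by auto
    have "(\<lambda>n. q n y) \<longlonglongrightarrow> h x y" if "y \<in> K" for y
    proof -
      have "((\<lambda>t. (g (x + t *\<^sub>R e) y - g x y) / t) \<longlongrightarrow> h x y) (at 0)"
        using deriv[OF U(2) that] by (simp add: DERIV_def)
      moreover have "filterlim (\<lambda>n. d / Suc n) (at 0) sequentially"
        unfolding filterlim_at
        using d LIMSEQ_Suc[OF lim_const_over_n[of d]] by (auto simp: field_simps)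
      ultimately show ?thesis unfolding q_def by (rule filterlim_compose)
    qed
    then show "AE y in lebesgue_on K. (\<lambda>n. v y * q n y) \<longlonglongrightarrow> v y * h x y"
      by (intro AE_I2 tendsto_intros) auto
    have "\<bar>q n y\<bar> \<le> B" if y: "y \<in> K" for n y
    proof -
      \<comment> \<open>By the mean value theorem the quotient is a value of the derivative on the
        segment, where B bounds it.\<close>
      have "\<exists>z. 0 < z \<and> z < d / Suc n \<and>
          g (x + (d / Suc n) *\<^sub>R e) y - g (x + 0 *\<^sub>R e) y = (d / Suc n - 0) * h (x + z *\<^sub>R e) y"
        by (rule MVT2) (use tn[of n] d der y in auto)
      then obtain z where "0 < z" "z < d / Suc n" "q n y = h (x + z *\<^sub>R e) y"
        using d by (auto simp: q_def)
      then show ?thesis using B[of z y] y tn[of n] by auto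
    qed
    then show "AE y in lebesgue_on K. norm (v y * q n y) \<le> B * \<bar>v y\<bar>" for n
      by (intro AE_I2) (auto simp: abs_mult mult.commute[of B] intro!: mult_left_mono)
  qed
  moreover have "(\<integral>y. v y * q n y \<partial>lebesgue_on K) = 0" for n
  proof -
    have "(\<integral>y. v y * q n y \<partial>lebesgue_on K) =
      (\<integral>y. (v y * g (x + (d / Suc n) *\<^sub>R e) y - v y * g x y) / (d / Suc n) \<partial>lebesgue_on K)"
      by (simp add: q_def algebra_simps)
    also have "\<dots> = (\<integral>y. v y * g (x + (d / Suc n) *\<^sub>R e) y - v y * g x y \<partial>lebesgue_on K) / (d / Suc n)"
      by simp
    also have "(\<integral>y. v y * g (x + (d / Suc n) *\<^sub>R e) y - v y * g x y \<partial>lebesgue_on K) = 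
       (\<integral>y. v y * g (x + (d / Suc n) *\<^sub>R e) y \<partial>lebesgue_on K) - (\<integral>y. v y * g x y \<partial>lebesgue_on K)"
      by (rule Bochner_Integration.integral_diff)
        (use integrable_mult_continuous_lebesgue_on[OF K v] gc inU[of "d / Suc n"] tn[of n] U in auto)
    also have "\<dots> = 0" using zero inU[of "d / Suc n"] tn[of n] U by auto
    finally show ?thesis by simp
  qed
  ultimately show ?thesis by (simp add: LIMSEQ_const_iff)
qed

section \<open>Unique continuation for Riesz potentials\<close>

text \<open>A nonempty open set is not negligible. This is how almost everywhere statements are
  turned into statements about chosen points.\<close>

lemma AE_lebesgue_open_witness:
  fixes S :: "'a::euclidean_space set"
  assumes "AE x in lebesgue. P x" and "open S" and "S \<noteq> {}"
  obtains x where "x \<in> S" "P x"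
proof -
  have "\<not> negligible S" using assms open_not_negligible by blast
  have "\<exists>x\<in>S. P x"
  proof (rule ccontr)
    assume "\<not> ?thesis"
    then have "AE x in lebesgue. x \<notin> S" using assms(1) by (auto elim!: AE_mp)
    then have "S \<in> null_sets lebesgue"
      using assms(2) AE_iff_null_sets[of S lebesgue] by auto
    then show False using \<open>\<not> negligible S\<close> by (simp add: negligible_iff_null_sets)
  qed
  then show ?thesis using that by blast
qed

section \<open>From powers of the distance to Gaussians\<close>

lemma inner_self_powr_directional_derivative:
  fixes y z e :: "'a::real_inner"
  assumes "y \<noteq> z"
  shows "((\<lambda>t. ((y - (z + t *\<^sub>R e)) \<bullet> (y - (z + t *\<^sub>R e))) powr q) has_real_derivative
     (- 2 * q) * ((y - z) \<bullet> (y - z)) powr (q - 1) * ((y - z) \<bullet> e)) (at 0)"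
proof -
  have eq: "(y - (z + t *\<^sub>R e)) \<bullet> (y - (z + t *\<^sub>R e)) =
      (y - z) \<bullet> (y - z) - 2 * t * ((y - z) \<bullet> e) + t * t * (e \<bullet> e)" for t
    by (simp add: inner_diff_left inner_diff_right inner_add_left inner_add_right inner_commute
        algebra_simps)
  have pos: "(y - z) \<bullet> (y - z) > 0" using assms by simp
  have "((\<lambda>t. ((y - z) \<bullet> (y - z) - 2 * t * ((y - z) \<bullet> e) + t * t * (e \<bullet> e)) powr q)
     has_real_derivative
     q * ((y - z) \<bullet> (y - z) - 2 * 0 * ((y - z) \<bullet> e) + 0 * 0 * (e \<bullet> e)) powr (q - of_nat 1)
       * (- 2 * ((y - z) \<bullet> e))) (at 0)"
    by (rule DERIV_fun_powr) (use pos in \<open>auto intro!: derivative_eq_intros\<close>)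
  then show ?thesis unfolding eq by (simp add: algebra_simps)
qed

text \<open>
  The Laplacian of \<open>|y - z|\<^bsup>2q\<^esup>\<close> in \<open>z\<close> is \<open>2q (2q - 2 + n) |y - z|\<^bsup>2q-2\<^esup>\<close>.
\<close>

lemma integral_radial_power_descent:
  fixes v :: "'a::euclidean_space \<Rightarrow> real"
  assumes K: "compact K" and v: "integrable (lebesgue_on K) v"
    and U: "open U" and disj: "U \<inter> K = {}"
    and q: "q \<noteq> 0" "2 * q - 2 + real DIM('a) \<noteq> 0"
    and zero: "\<And>z. z \<in> U \<Longrightarrow> (\<integral>y. v y * ((y - z) \<bullet> (y - z)) powr q \<partial>lebesgue_on K) = 0"
    and x: "x \<in> U"
  shows "(\<integral>y. v y * ((y - x) \<bullet> (y - x)) powr (q - 1) \<partial>lebesgue_on K) = 0"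
proof -
  have ne: "y \<noteq> z" if "z \<in> U" "y \<in> K" for y z using disj that by auto
  have powc: "continuous_on (U \<times> K) (\<lambda>(z, y). ((y - z) \<bullet> (y - z)) powr r)" for r
    unfolding split_def by (intro continuous_intros) (auto dest: ne)
  have powc1: "continuous_on K (\<lambda>y. ((y - z) \<bullet> (y - z)) powr r)" if "z \<in> U" for r z
    using that by (intro continuous_intros) (auto dest: ne)
  \<comment> \<open>\<open>h1\<close> and the later \<open>h2\<close> are the first and second
    derivatives of the kernel along e with respect to the centre z, not to y.\<close>
  define h1 where "h1 e z y = (- 2 * q) * ((y - z) \<bullet> (y - z)) powr (q - 1) * ((y - z) \<bullet> e)"
    for e z y :: 'a
  have h1c: "continuous_on (U \<times> K) (\<lambda>(z, y). h1 e z y)" for e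
    unfolding h1_def split_def by (intro continuous_intros) (auto dest: ne)
  have h1c1: "continuous_on K (h1 e z)" if "z \<in> U" for e z
    unfolding h1_def using that by (intro continuous_intros) (auto dest: ne)
  have Z1: "(\<integral>y. v y * h1 e z y \<partial>lebesgue_on K) = 0" if "z \<in> U" for e z
  proof (rule integral_parameter_derivative_zero[OF K v U that zero powc1 h1c])
    show "((\<lambda>t. ((y - (w + t *\<^sub>R e)) \<bullet> (y - (w + t *\<^sub>R e))) powr q) has_real_derivative h1 e w y) (at 0)"
      if "w \<in> U" "y \<in> K" for w y
      unfolding h1_def by (rule inner_self_powr_directional_derivative[OF ne[OF that]])
  qed
  define h2 where "h2 e z y = (4 * q * (q - 1)) * ((y - z) \<bullet> (y - z)) powr (q - 2) * ((y - z) \<bullet> e)\<^sup>2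
      + 2 * q * ((y - z) \<bullet> (y - z)) powr (q - 1) * (e \<bullet> e)"
    for e z y :: 'a
  have h2c: "continuous_on (U \<times> K) (\<lambda>(z, y). h2 e z y)" for e
    unfolding h2_def split_def by (intro continuous_intros) (auto dest: ne)
  have h2c1: "continuous_on K (h2 e z)" if "z \<in> U" for e z
    unfolding h2_def using that by (intro continuous_intros) (auto dest: ne)
  have Z2: "(\<integral>y. v y * h2 e x y \<partial>lebesgue_on K) = 0" for e
  proof (rule integral_parameter_derivative_zero[OF K v U x Z1[of _ e] h1c1 h2c])
    fix z y assume zy: "z \<in> U" "y \<in> K"
    have D: "((\<lambda>t. (y - (z + t *\<^sub>R e)) \<bullet> e) has_real_derivative - (e \<bullet> e)) (at 0)"
      unfolding inner_diff_left inner_add_left inner_scaleR_left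
      by (auto intro!: derivative_eq_intros)
    have "((\<lambda>t. (- 2 * q) * (((y - (z + t *\<^sub>R e)) \<bullet> (y - (z + t *\<^sub>R e))) powr (q - 1)
          * ((y - (z + t *\<^sub>R e)) \<bullet> e))) has_real_derivative
       (- 2 * q) * ((- 2 * (q - 1)) * ((y - z) \<bullet> (y - z)) powr (q - 1 - 1) * ((y - z) \<bullet> e)
           * ((y - (z + 0 *\<^sub>R e)) \<bullet> e)
         + - (e \<bullet> e) * ((y - (z + 0 *\<^sub>R e)) \<bullet> (y - (z + 0 *\<^sub>R e))) powr (q - 1))) (at 0)"
      by (rule DERIV_cmult DERIV_mult inner_self_powr_directional_derivative[OF ne[OF zy]] D)+
    then show "((\<lambda>t. h1 e (z + t *\<^sub>R e) y) has_real_derivative h2 e z y) (at 0)"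
      unfolding h1_def
      by (rule DERIV_cong[OF DERIV_cong_ev[THEN iffD1, OF refl _ refl], rotated])
        (auto simp: h2_def algebra_simps power2_eq_square)
  qed auto
  \<comment> \<open>Over an orthonormal basis the squares
    \<open>((y - x) \<bullet> e)\<^sup>2\<close> add up to the squared distance, which raises the
    exponent q - 2 to q - 1; the coefficients combine to 4 q (q - 1) + 2 q n.\<close>
  have lap: "(\<Sum>e\<in>Basis. h2 e x y) =
      2 * q * (2 * q - 2 + real DIM('a)) * ((y - x) \<bullet> (y - x)) powr (q - 1)" if "y \<in> K" for y
  proof -
    have pos: "(y - x) \<bullet> (y - x) > 0" using ne[OF x that] by simp
    have "(\<Sum>e\<in>Basis. h2 e x y) =
      4 * q * (q - 1) * ((y - x) \<bullet> (y - x)) powr (q - 2) * (\<Sum>e\<in>Basis. ((y - x) \<bullet> e)\<^sup>2)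
      + (\<Sum>e\<in>(Basis::'a set). 2 * q * ((y - x) \<bullet> (y - x)) powr (q - 1))"
      unfolding h2_def sum.distrib sum_distrib_left by (simp add: inner_Basis)
    also have "(\<Sum>e\<in>Basis. ((y - x) \<bullet> e)\<^sup>2) = (y - x) \<bullet> (y - x)"
      by (simp add: euclidean_inner[of "y - x" "y - x"] power2_eq_square)
    also have "4 * q * (q - 1) * ((y - x) \<bullet> (y - x)) powr (q - 2) * ((y - x) \<bullet> (y - x))
        = 4 * q * (q - 1) * ((y - x) \<bullet> (y - x)) powr (q - 1)"
      using powr_add[of "(y - x) \<bullet> (y - x)" "q - 2" 1] pos by simp
    also have "(\<Sum>e\<in>(Basis::'a set). 2 * q * ((y - x) \<bullet> (y - x)) powr (q - 1)) =
        real DIM('a) * (2 * q * ((y - x) \<bullet> (y - x)) powr (q - 1))"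
      by simp
    finally show ?thesis by (simp only: ring_distribs mult_ac)
  qed
  have "0 = (\<Sum>e\<in>(Basis::'a set). \<integral>y. v y * h2 e x y \<partial>lebesgue_on K)" using Z2 by simp
  also have "\<dots> = (\<integral>y. (\<Sum>e\<in>Basis. v y * h2 e x y) \<partial>lebesgue_on K)"
    by (rule Bochner_Integration.integral_sum[symmetric])
      (rule integrable_mult_continuous_lebesgue_on[OF K v h2c1[OF x]])
  also have "\<dots> = (\<integral>y. 2 * q * (2 * q - 2 + real DIM('a)) * (v y * ((y - x) \<bullet> (y - x)) powr (q - 1))
        \<partial>lebesgue_on K)"
    by (intro Bochner_Integration.integral_cong refl) (simp add: sum_distrib_left[symmetric] lap)
  also have "\<dots> = 2 * q * (2 * q - 2 + real DIM('a)) *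
       (\<integral>y. v y * ((y - x) \<bullet> (y - x)) powr (q - 1) \<partial>lebesgue_on K)" by simp
  finally show ?thesis using q by simp
qed

text \<open>Iterated descent says that the weighted density \<open>w\<close> is orthogonal to every
  power of 1 / r, where r is the squared distance to x. By Weierstrass it is then orthogonal to
  every continuous function of 1 / r on the compact range \<open>I\<close>, and the Gaussian is such
  a function up to the weight.\<close>

lemma integral_gaussian_zero:
  fixes v :: "'a::euclidean_space \<Rightarrow> real"
  assumes K: "compact K" and v: "integrable (lebesgue_on K) v"
    and U: "open U" and disj: "U \<inter> K = {}"
    and q: "q > 0" "2 * q + 2 > real DIM('a)"
    and zero: "\<And>z. z \<in> U \<Longrightarrow> (\<integral>y. v y * ((y - z) \<bullet> (y - z)) powr (- q) \<partial>lebesgue_on K) = 0"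
    and x: "x \<in> U"
  shows "(\<integral>y. v y * exp (- c * ((y - x) \<bullet> (y - x))) \<partial>lebesgue_on K) = 0"
proof (cases "K = {}")
  case True then show ?thesis by simp
next
  case nonempty: False
  have Zk: "(\<integral>y. v y * ((y - z) \<bullet> (y - z)) powr (- q - real k) \<partial>lebesgue_on K) = 0"
    if "z \<in> U" for k z using that
  proof (induction k arbitrary: z)
    case 0 then show ?case using zero by simp
  next
    case (Suc k)
    \<comment> \<open>At the exponent p = -q - k the factor 2 p - 2 + n equals n - 2 - 2 q - 2 k,
      which is negative by the assumption on q.\<close>
    have "(\<integral>y. v y * ((y - z) \<bullet> (y - z)) powr (- q - real k - 1) \<partial>lebesgue_on K) = 0"
      by (rule integral_radial_power_descent[OF K v U disj])
        (use q Suc in auto)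
    then show ?case by (simp add: algebra_simps)
  qed
  define r where "r y = (y - x) \<bullet> (y - x)" for y
  have rc: "continuous_on S r" for S unfolding r_def by (intro continuous_intros)
  have rpos: "r y > 0" if "y \<in> K" for y using disj x that by (auto simp: r_def)
  define w where "w y = v y * r y powr (- q)" for y
  have rqc: "continuous_on K (\<lambda>y. r y powr p)" for p
    by (intro continuous_intros rc) (use rpos in force)+
  have w: "integrable (lebesgue_on K) w" unfolding w_def
    by (rule integrable_mult_continuous_lebesgue_on[OF K v rqc])
  \<comment> \<open>With \<rho> = 1 / r the power of \<rho> cancels the weight in \<open>w\<close>,
    and the exponential becomes exp (- c r).\<close>
  define G where "G = (\<lambda>\<rho>. \<rho> powr (- q) * exp (- c / \<rho>))"
  define I where "I = (\<lambda>y. 1 / r y) ` K"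
  have irc: "continuous_on K (\<lambda>y. 1 / r y)"
    by (intro continuous_intros rc) (use rpos in force)
  have I: "compact I" unfolding I_def by (rule compact_continuous_image[OF irc K])
  have Gc: "continuous_on I G" unfolding G_def I_def
    by (intro continuous_intros) (use rpos in force)+
  have GcK: "continuous_on K (\<lambda>y. G (1 / r y))"
    using continuous_on_compose2[OF Gc irc] by (auto simp: I_def)
  have "(\<integral>y. w y * G (1 / r y) \<partial>lebesgue_on K) = 0"
  proof (rule integral_zero_uniform_closure[OF K w GcK])
    fix \<epsilon> :: real assume "\<epsilon> > 0"
    obtain p where p: "real_polynomial_function p" "\<And>\<rho>. \<rho> \<in> I \<Longrightarrow> \<bar>G \<rho> - p \<rho>\<bar> < \<epsilon>"
      using Stone_Weierstrass_real_polynomial_function[OF I Gc \<open>\<epsilon> > 0\<close>] by blast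
    obtain a n where pn: "p = (\<lambda>\<rho>. \<Sum>i\<le>n. a i * \<rho> ^ i)"
      using p(1) real_polynomial_function_iff_sum by blast
    have pc: "continuous_on K (\<lambda>y. p (1 / r y))"
      unfolding pn by (intro continuous_intros rc) (use rpos in force)+
    have "(\<integral>y. w y * p (1 / r y) \<partial>lebesgue_on K) =
       (\<integral>y. (\<Sum>i\<le>n. a i * (v y * r y powr (- q - real i))) \<partial>lebesgue_on K)"
    proof (intro Bochner_Integration.integral_cong refl)
      fix y assume "y \<in> space (lebesgue_on K)"
      then have "r y > 0" using rpos by simp
      then have "r y powr (- q) * (1 / r y) ^ i = r y powr (- q - real i)" for i
        by (simp add: powr_diff powr_realpow power_divide)
      then show "w y * p (1 / r y) = (\<Sum>i\<le>n. a i * (v y * r y powr (- q - real i)))"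
        unfolding w_def pn sum_distrib_left
        by (intro sum.cong refl) (metis (no_types, lifting) mult.assoc mult.left_commute)
    qed
    also have "\<dots> = (\<Sum>i\<le>n. \<integral>y. a i * (v y * r y powr (- q - real i)) \<partial>lebesgue_on K)"
      by (rule Bochner_Integration.integral_sum)
        (use integrable_mult_continuous_lebesgue_on[OF K v rqc] in auto)
    also have "\<dots> = 0" using Zk[OF x] by (simp add: r_def)
    finally show "\<exists>h. continuous_on K h \<and> (\<integral>y. w y * h y \<partial>lebesgue_on K) = 0 \<and>
              (\<forall>y\<in>K. \<bar>G (1 / r y) - h y\<bar> < \<epsilon>)"
      using pc p(2) by (intro exI[of _ "\<lambda>y. p (1 / r y)"]) (auto simp: I_def)
  qed
  also have "(\<integral>y. w y * G (1 / r y) \<partial>lebesgue_on K) = (\<integral>y. v y * exp (- c * r y) \<partial>lebesgue_on K)"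
  proof (intro Bochner_Integration.integral_cong refl)
    fix y assume "y \<in> space (lebesgue_on K)"
    then have "r y > 0" using rpos by simp
    then have "r y powr (- q) * (1 / r y) powr (- q) = 1"
      by (simp add: powr_minus powr_divide field_simps)
    then show "w y * G (1 / r y) = v y * exp (- c * r y)"
      using \<open>r y > 0\<close> by (simp add: w_def G_def algebra_simps)
  qed
  finally show ?thesis by (simp add: r_def)
qed

text \<open>
  Up to constant factors the generators are the Gaussians \<open>exp (- c |y - x|\<^sup>2)\<close> centred in \<open>U\<close>; written
  this way, multiplying two of them just adds \<open>c\<close> and \<open>c x\<close>, so convexity of \<open>U\<close> gives an algebra.
\<close>

inductive_set gaussian_span :: "'a::real_inner set \<Rightarrow> ('a \<Rightarrow> real) set" for U where
  base: "c \<ge> 0 \<Longrightarrow> x \<in> U \<Longrightarrow> (\<lambda>y. a * exp (2 * ((c *\<^sub>R x) \<bullet> y) - c * (y \<bullet> y))) \<in> gaussian_span U"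
| add: "f \<in> gaussian_span U \<Longrightarrow> g \<in> gaussian_span U \<Longrightarrow> (\<lambda>y. f y + g y) \<in> gaussian_span U"

lemma gaussian_span_mult_base:
  assumes U: "convex U" and c: "c \<ge> 0" "x \<in> U" and f: "f \<in> gaussian_span U"
  shows "(\<lambda>y. a * exp (2 * ((c *\<^sub>R x) \<bullet> y) - c * (y \<bullet> y)) * f y) \<in> gaussian_span U"
  using f
proof induction
  case (base d z b)
  \<comment> \<open>The new centre is the mean of x and z with weights c and d. If both weights are
    0 there is no mean, but then the generators are constants and any centre will do.\<close>
  obtain w where w: "w \<in> U" "c *\<^sub>R x + d *\<^sub>R z = (c + d) *\<^sub>R w"
  proof (cases "c + d = 0")
    case True
    then have "c = 0" "d = 0" using c base by auto
    then show ?thesis using that[OF c(2)] by simp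
  next
    case False
    have "(c / (c + d)) *\<^sub>R x + (d / (c + d)) *\<^sub>R z \<in> U"
      by (rule convexD[OF U]) (use c base False in \<open>auto simp: add_divide_distrib[symmetric]\<close>)
    then show ?thesis by (rule that) (use False in \<open>simp add: scaleR_add_right\<close>)
  qed
  have "(\<lambda>y. (a * b) * exp (2 * (((c + d) *\<^sub>R w) \<bullet> y) - (c + d) * (y \<bullet> y))) \<in> gaussian_span U"
    by (rule gaussian_span.base) (use c base w in auto)
  also have "(\<lambda>y. (a * b) * exp (2 * (((c + d) *\<^sub>R w) \<bullet> y) - (c + d) * (y \<bullet> y))) =
     (\<lambda>y. a * exp (2 * ((c *\<^sub>R x) \<bullet> y) - c * (y \<bullet> y)) * (b * exp (2 * ((d *\<^sub>R z) \<bullet> y) - d * (y \<bullet> y))))"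
  proof
    fix y
    have "2 * (((c + d) *\<^sub>R w) \<bullet> y) - (c + d) * (y \<bullet> y) =
      (2 * ((c *\<^sub>R x) \<bullet> y) - c * (y \<bullet> y)) + (2 * ((d *\<^sub>R z) \<bullet> y) - d * (y \<bullet> y))"
      unfolding w(2)[symmetric] by (simp add: inner_add_left algebra_simps)
    then show "(a * b) * exp (2 * (((c + d) *\<^sub>R w) \<bullet> y) - (c + d) * (y \<bullet> y)) =
     a * exp (2 * ((c *\<^sub>R x) \<bullet> y) - c * (y \<bullet> y)) * (b * exp (2 * ((d *\<^sub>R z) \<bullet> y) - d * (y \<bullet> y)))"
      by (simp only: exp_add mult_ac)
  qed
  finally show ?case .
next
  case (add f g)
  then show ?case using gaussian_span.add[OF add.IH] by (simp add: algebra_simps)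
qed

text \<open>Constants are the generators with c = 0. Points are separated by c = 1: if all
  generators agreed at y and z, every centre in \<open>U\<close> would be equidistant from both,
  which is impossible for two centres that differ by a positive multiple of y - z.\<close>

lemma function_ring_on_gaussian_span:
  fixes K U :: "'a::euclidean_space set"
  assumes "compact K" "open U" "convex U" "U \<noteq> {}"
  shows "function_ring_on (gaussian_span U) K"
proof
  show "compact K" by fact
  show "continuous_on K f" if "f \<in> gaussian_span U" for f
    using that by induction (auto intro!: continuous_intros)
  show "(\<lambda>y. f y + g y) \<in> gaussian_span U" if "f \<in> gaussian_span U" "g \<in> gaussian_span U" for f g
    using gaussian_span.add that .
  show "(\<lambda>y. f y * g y) \<in> gaussian_span U" if "f \<in> gaussian_span U" "g \<in> gaussian_span U" for f g
    using that(1)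
  proof induction
    case (base c x a)
    then show ?case using gaussian_span_mult_base[OF assms(3) _ _ that(2)] by blast
  next
    case (add f1 f2)
    then show ?case using gaussian_span.add[OF add.IH] by (simp add: algebra_simps)
  qed
  obtain x where x: "x \<in> U" using assms by auto
  show "(\<lambda>_. c) \<in> gaussian_span U" for c
    using gaussian_span.base[OF order_refl x, of c] by simp
  fix y z :: 'a assume "y \<noteq> z"
  obtain r where r: "r > 0" "cball x r \<subseteq> U" using assms(2) x open_contains_cball by blast
  \<comment> \<open>The shift by \<open>t *\<^sub>R (y - z)\<close> has length exactly r, so the
    second centre stays in the closed ball.\<close>
  define t where "t = r / norm (y - z)"
  have t: "t > 0" using r \<open>y \<noteq> z\<close> by (simp add: t_def)
  have x': "x + t *\<^sub>R (y - z) \<in> U"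
    using r \<open>y \<noteq> z\<close> by (intro subsetD[OF r(2)]) (auto simp: dist_norm t_def)
  show "\<exists>f\<in>gaussian_span U. f y \<noteq> f z"
  proof (rule ccontr)
    assume "\<not> ?thesis"
    then have eq: "f y = f z" if "f \<in> gaussian_span U" for f using that by blast
    have "2 * (w \<bullet> y) - y \<bullet> y = 2 * (w \<bullet> z) - z \<bullet> z" if "w \<in> U" for w
      using eq[OF gaussian_span.base[of 1 w U 1]] that by simp
    from this[OF x] this[OF x'] have eqs: "2 * (x \<bullet> y) - y \<bullet> y = 2 * (x \<bullet> z) - z \<bullet> z"
      "2 * (x \<bullet> y) + 2 * (t * ((y - z) \<bullet> y)) - y \<bullet> y =
       2 * (x \<bullet> z) + 2 * (t * ((y - z) \<bullet> z)) - z \<bullet> z"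
      unfolding inner_add_left inner_scaleR_left distrib_left .
    have "r1 = r2" if "2 * a - b = 2 * c - d" "2 * a + 2 * r1 - b = 2 * c + 2 * r2 - d"
      for a b c d r1 r2 :: real using that by linarith
    from this[OF eqs] have "t * ((y - z) \<bullet> y) = t * ((y - z) \<bullet> z)" .
    then have "t * ((y - z) \<bullet> (y - z)) = 0"
      unfolding inner_diff_right[of "y - z"] by (simp add: right_diff_distrib)
    then show False using t \<open>y \<noteq> z\<close> by simp
  qed
qed

text \<open>The bound on q excludes the Newtonian kernel, for which the claim fails when n >= 3: a
  radial density of total mass zero has vanishing potential outside its support.\<close>

lemma riesz_potential_unique_continuation:
  fixes v :: "'a::euclidean_space \<Rightarrow> real"
  assumes K: "compact K" and v: "integrable (lebesgue_on K) v"
    and U: "open U" "convex U" "U \<noteq> {}" and disj: "U \<inter> K = {}"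
    and q: "q > 0" "2 * q + 2 > real DIM('a)"
    and zero: "AE z in lebesgue. z \<in> U \<longrightarrow>
       (\<integral>y. v y * ((y - z) \<bullet> (y - z)) powr (- q) \<partial>lebesgue_on K) = 0"
  shows "AE y in lebesgue_on K. v y = 0"
proof -
  have ne: "y \<noteq> z" if "z \<in> U" "y \<in> K" for y z using disj that by auto
  \<comment> \<open>The descent differentiates in z and so needs the potential to vanish at every
    point of \<open>U\<close>. Good centres lie arbitrarily near x, and their kernels approximate
    the one at x uniformly on \<open>K\<close>.\<close>
  have Z: "(\<integral>y. v y * ((y - x) \<bullet> (y - x)) powr (- q) \<partial>lebesgue_on K) = 0" if x: "x \<in> U" for x
  proof (rule integral_zero_uniform_closure[OF K v])
    show "continuous_on K (\<lambda>y. ((y - x) \<bullet> (y - x)) powr (- q))"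
      using x by (intro continuous_intros) (auto dest: ne)
    fix \<epsilon> :: real assume "\<epsilon> > 0"
    obtain r where r: "r > 0" "cball x r \<subseteq> U" using U x open_contains_cball by blast
    have "continuous_on (cball x r \<times> K) (\<lambda>(z, y). ((y - z) \<bullet> (y - z)) powr (- q))"
      unfolding split_def using r by (intro continuous_intros) (force dest: ne)
    then have "uniformly_continuous_on (cball x r \<times> K) (\<lambda>(z, y). ((y - z) \<bullet> (y - z)) powr (- q))"
      using K by (intro compact_uniformly_continuous compact_Times) auto
    then obtain d where d: "d > 0" "\<And>a b. a \<in> cball x r \<times> K \<Longrightarrow> b \<in> cball x r \<times> K \<Longrightarrow> dist b a < d \<Longrightarrow>
       dist ((\<lambda>(z, y). ((y - z) \<bullet> (y - z)) powr (- q)) b) ((\<lambda>(z, y). ((y - z) \<bullet> (y - z)) powr (- q)) a) < \<epsilon>"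
      using \<open>\<epsilon> > 0\<close> by (rule uniformly_continuous_onE) blast
    have "open (ball x (min d r))" "ball x (min d r) \<noteq> {}" using d r by auto
    with zero obtain z where z: "z \<in> ball x (min d r)"
      "z \<in> U \<longrightarrow> (\<integral>y. v y * ((y - z) \<bullet> (y - z)) powr (- q) \<partial>lebesgue_on K) = 0"
      by (rule AE_lebesgue_open_witness)
    have zU: "z \<in> U" using z r by auto
    show "\<exists>h. continuous_on K h \<and> (\<integral>y. v y * h y \<partial>lebesgue_on K) = 0 \<and>
        (\<forall>y\<in>K. \<bar>((y - x) \<bullet> (y - x)) powr (- q) - h y\<bar> < \<epsilon>)"
    proof (intro exI[of _ "\<lambda>y. ((y - z) \<bullet> (y - z)) powr (- q)"] conjI ballI)
      show "continuous_on K (\<lambda>y. ((y - z) \<bullet> (y - z)) powr (- q))"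
        using zU by (intro continuous_intros) (auto dest: ne)
      fix y assume "y \<in> K"
      then show "\<bar>((y - x) \<bullet> (y - x)) powr (- q) - ((y - z) \<bullet> (y - z)) powr (- q)\<bar> < \<epsilon>"
        using d(2)[of "(z, y)" "(x, y)"] z r(1) by (auto simp: dist_Pair_Pair dist_norm)
    qed (use z zU in blast)
  qed
  show ?thesis
  proof (rule AE_zero_if_orthogonal_ring[OF function_ring_on_gaussian_span[OF K U] v])
    fix g assume "g \<in> gaussian_span U"
    then show "(\<integral>y. v y * g y \<partial>lebesgue_on K) = 0"
    proof induction
      case (base c x a)
      have "(\<integral>y. v y * (a * exp (2 * (c *\<^sub>R x \<bullet> y) - c * (y \<bullet> y))) \<partial>lebesgue_on K) =
         (\<integral>y. (a * exp (c * (x \<bullet> x))) * (v y * exp (- c * ((y - x) \<bullet> (y - x)))) \<partial>lebesgue_on K)"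
      proof (intro Bochner_Integration.integral_cong refl)
        fix y
        \<comment> \<open>Completing the square: the generator is the Gaussian centred at x up to a
          factor that does not depend on y.\<close>
        have "2 * (c *\<^sub>R x \<bullet> y) - c * (y \<bullet> y) = c * (x \<bullet> x) + (- c * ((y - x) \<bullet> (y - x)))"
          by (simp add: inner_diff_left inner_diff_right inner_commute algebra_simps)
        then show "v y * (a * exp (2 * (c *\<^sub>R x \<bullet> y) - c * (y \<bullet> y))) =
          (a * exp (c * (x \<bullet> x))) * (v y * exp (- c * ((y - x) \<bullet> (y - x))))"
          by (simp only: exp_add mult_ac)
      qed
      also have "\<dots> = a * exp (c * (x \<bullet> x)) * (\<integral>y. v y * exp (- c * ((y - x) \<bullet> (y - x))) \<partial>lebesgue_on K)"
        by (rule integral_mult_right_zero)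
      also have "\<dots> = 0"
        using integral_gaussian_zero[OF K v U(1) disj q Z base(2)] by simp
      finally show ?case .
    next
      case (add f g)
      have "(\<integral>y. v y * (f y + g y) \<partial>lebesgue_on K) =
        (\<integral>y. v y * f y \<partial>lebesgue_on K) + (\<integral>y. v y * g y \<partial>lebesgue_on K)"
        unfolding distrib_left
        by (rule Bochner_Integration.integral_add)
          (use integrable_mult_continuous_lebesgue_on[OF K v] add.hyps
            function_ring_on.continuous[OF function_ring_on_gaussian_span[OF K U]] in auto)
      then show ?case using add by simp
    qed
  qed
qed

section \<open>Test functions in time\<close>

text \<open>The classical flat function exp (- 1 / t), extended by 0. The denominators are carried
  along so that the derivative of a member is a linear combination of members.\<close>

definition flat_exp :: "nat \<Rightarrow> real \<Rightarrow> real" where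
  "flat_exp k t = (if t > 0 then exp (- 1 / t) / t ^ k else 0)"

text \<open>With s = 1 / t the limit from the right is that of s^k / exp s at infinity.\<close>

lemma flat_exp_tendsto_0: "(flat_exp k \<longlongrightarrow> 0) (at 0)"
proof -
  have "((\<lambda>t :: real. (inverse t) ^ k / exp (inverse t)) \<longlongrightarrow> 0) (at_right 0)"
    using filterlim_compose[OF tendsto_power_div_exp_0[of k] filterlim_inverse_at_top_right] .
  then have "(flat_exp k \<longlongrightarrow> 0) (at_right 0)"
    by (rule Lim_transform_eventually)
      (auto simp: flat_exp_def eventually_at_right_field exp_minus field_simps intro!: exI[of _ 1])
  moreover have "(flat_exp k \<longlongrightarrow> 0) (at_left 0)"
    by (rule Lim_transform_eventually[OF tendsto_const])
      (auto simp: flat_exp_def eventually_at_left_field intro!: exI[of _ "-1"])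
  ultimately show ?thesis by (simp add: filterlim_split_at)
qed

lemma flat_exp_deriv:
  "(flat_exp k has_real_derivative flat_exp (k + 2) t - real k * flat_exp (k + 1) t) (at t)"
proof (cases t "0 :: real" rule: linorder_cases)
  case less
  have "((\<lambda>_. 0) has_real_derivative 0) (at t)" by simp
  then have "(flat_exp k has_real_derivative 0) (at t)"
    by (rule has_field_derivative_transform_within_open[of _ _ _ "{..<0}"])
      (use less in \<open>auto simp: flat_exp_def\<close>)
  then show ?thesis using less by (simp add: flat_exp_def)
next
  case equal
  \<comment> \<open>At 0 the difference quotient of \<open>flat_exp k\<close> is
    \<open>flat_exp (k + 1)\<close> itself, which tends to 0.\<close>
  have "((\<lambda>h. (flat_exp k (0 + h) - flat_exp k 0) / h) \<longlongrightarrow> 0) (at 0)"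
    by (rule Lim_transform_eventually[OF flat_exp_tendsto_0[of "k + 1"]])
      (auto simp: flat_exp_def eventually_at_filter)
  then show ?thesis using equal by (simp add: DERIV_def flat_exp_def)
next
  case greater
  have "((\<lambda>t. exp (- 1 / t) / t ^ k) has_real_derivative
     (exp (- 1 / t) * (1 / t\<^sup>2) * t ^ k - exp (- 1 / t) * (real k * t ^ (k - 1))) / (t ^ k * t ^ k)) (at t)"
    using greater by (auto intro!: derivative_eq_intros simp: power2_eq_square)
  also have "(exp (- 1 / t) * (1 / t\<^sup>2) * t ^ k - exp (- 1 / t) * (real k * t ^ (k - 1))) / (t ^ k * t ^ k)
    = exp (- 1 / t) / t ^ (k + 2) - real k * (exp (- 1 / t) / t ^ (k + 1))"
    using greater by (cases k) (auto simp: field_simps power2_eq_square)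
  finally have "(flat_exp k has_real_derivative
      exp (- 1 / t) / t ^ (k + 2) - real k * (exp (- 1 / t) / t ^ (k + 1))) (at t)"
    by (rule has_field_derivative_transform_within_open[of _ _ _ "{0<..}"])
      (use greater in \<open>auto simp: flat_exp_def\<close>)
  then show ?thesis using greater by (simp add: flat_exp_def)
qed

text \<open>A class closed under differentiation and large enough to contain the cut-offs below.
  Smoothness of all its members then follows by one induction on the order, without formulas for
  higher derivatives.\<close>

inductive_set flat_exp_algebra :: "(real \<Rightarrow> real) set" where
  const: "(\<lambda>_. c) \<in> flat_exp_algebra"
| ident: "(\<lambda>t. t) \<in> flat_exp_algebra"
| flat: "(\<lambda>t. flat_exp k (a * t + b)) \<in> flat_exp_algebra"
| add: "f \<in> flat_exp_algebra \<Longrightarrow> g \<in> flat_exp_algebra \<Longrightarrow> (\<lambda>t. f t + g t) \<in> flat_exp_algebra"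
| mult: "f \<in> flat_exp_algebra \<Longrightarrow> g \<in> flat_exp_algebra \<Longrightarrow> (\<lambda>t. f t * g t) \<in> flat_exp_algebra"

lemma flat_exp_algebra_power: "f \<in> flat_exp_algebra \<Longrightarrow> (\<lambda>t. f t ^ n) \<in> flat_exp_algebra"
  by (induction n) (auto intro: flat_exp_algebra.intros)

lemma flat_exp_algebra_deriv:
  assumes "f \<in> flat_exp_algebra"
  shows "\<exists>g\<in>flat_exp_algebra. \<forall>t. (f has_real_derivative g t) (at t)"
  using assms
proof induction
  case (const c)
  show ?case by (rule bexI[OF _ flat_exp_algebra.const[of 0]]) auto
next
  case ident
  show ?case by (rule bexI[OF _ flat_exp_algebra.const[of 1]]) auto
next
  case (flat k a b)
  have mem: "(\<lambda>t. a * (flat_exp (k + 2) (a * t + b) + (- real k) * flat_exp (k + 1) (a * t + b)))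
      \<in> flat_exp_algebra"
    by (intro flat_exp_algebra.intros)
  have "((\<lambda>t. flat_exp k (a * t + b)) has_real_derivative
      (flat_exp (k + 2) (a * t + b) - real k * flat_exp (k + 1) (a * t + b)) * a) (at t)" for t
    by (rule DERIV_chain2[OF flat_exp_deriv]) (auto intro!: derivative_eq_intros)
  then show ?case by (intro bexI[OF _ mem]) (simp add: mult.commute)
next
  case (add f g)
  then obtain f' g' where "f' \<in> flat_exp_algebra" "\<And>t. (f has_real_derivative f' t) (at t)"
    "g' \<in> flat_exp_algebra" "\<And>t. (g has_real_derivative g' t) (at t)" by blast
  then show ?case
    by (intro bexI[of _ "\<lambda>t. f' t + g' t"]) (auto intro: flat_exp_algebra.intros DERIV_add)
next
  case (mult f g)
  then obtain f' g' where "f' \<in> flat_exp_algebra" "\<And>t. (f has_real_derivative f' t) (at t)"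
    "g' \<in> flat_exp_algebra" "\<And>t. (g has_real_derivative g' t) (at t)" by blast
  then show ?case using mult.hyps
    by (intro bexI[of _ "\<lambda>t. f' t * g t + g' t * f t"]) (auto intro: flat_exp_algebra.intros DERIV_mult)
qed

lemma flat_exp_algebra_smooth:
  assumes "f \<in> flat_exp_algebra"
  shows "smooth_on UNIV f"
proof -
  have "Ck_on k UNIV f" for k using assms
  proof (induction k arbitrary: f)
    case 0
    then show ?case
      using flat_exp_algebra_deriv[OF 0] by (auto intro!: DERIV_atLeastAtMost_imp_continuous_on
          continuous_at_imp_continuous_on DERIV_isCont)
  next
    case (Suc k)
    obtain g where g: "g \<in> flat_exp_algebra" "\<And>t. (f has_real_derivative g t) (at t)"
      using flat_exp_algebra_deriv[OF Suc.prems] by blast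
    \<comment> \<open>The only basis vector of the reals is 1, so the partial derivative in
      \<open>Ck_on\<close> is g, again a member of the class.\<close>
    have fd: "frechet_derivative f (at t) = (*) (g t)" for t
      using frechet_derivative_at[OF g(2)[of t, unfolded has_field_derivative_def]] by simp
    have "f differentiable_on UNIV"
      using g(2) by (fastforce simp: differentiable_on_def real_differentiable_def intro: differentiable_at_withinI)
    then show ?case using Suc.IH[OF g(1)] by (simp add: fd)
  qed
  then show ?thesis by (simp add: smooth_on_def)
qed

text \<open>The two flat factors cut the monomial off to the interval from 1 / n to t0 - 1 / n and
  tend to 1 inside (0, t0). With k and n this gives a countable family of test functions whose
  limits are all monomials on (0, t0).\<close>

definition time_bump :: "real \<Rightarrow> nat \<Rightarrow> nat \<Rightarrow> real \<Rightarrow> real" where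
  "time_bump t0 k n t = t ^ k * (flat_exp 0 (real n * t - 1) * flat_exp 0 (real n * (t0 - t) - 1))"

lemma time_bump_algebra: "time_bump t0 k n \<in> flat_exp_algebra"
proof -
  have "(\<lambda>t. t ^ k * (flat_exp 0 (real n * t + (- 1)) * flat_exp 0 (- real n * t + (real n * t0 - 1))))
      \<in> flat_exp_algebra"
    by (intro flat_exp_algebra.intros flat_exp_algebra_power)
  then show ?thesis by (simp add: time_bump_def[abs_def] algebra_simps)
qed

lemma time_bump_nonzero:
  assumes "n > 0" "time_bump t0 k n t \<noteq> 0"
  shows "t \<in> {1 / real n..t0 - 1 / real n}"
proof -
  have "real n * t > 1" "real n * (t0 - t) > 1"
    using assms(2) by (auto simp: time_bump_def flat_exp_def split: if_splits)
  then have "1 / real n < t" "1 / real n < t0 - t"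
    using assms(1) by (simp_all add: pos_divide_less_eq mult.commute)
  then show ?thesis by simp
qed

lemma test_function_time_bump:
  assumes "n > 0" "t0 \<le> T"
  shows "test_function {0<..<T} (time_bump t0 k n)"
proof -
  have sub: "closure {t. time_bump t0 k n t \<noteq> 0} \<subseteq> {1 / real n..t0 - 1 / real n}"
    by (rule closure_minimal) (use time_bump_nonzero[OF assms(1)] in blast)+
  have "compact (closure {t. time_bump t0 k n t \<noteq> 0})"
    using bounded_subset[OF bounded_closed_interval sub] by (simp add: compact_eq_bounded_closed)
  moreover have "{1 / real n..t0 - 1 / real n} \<subseteq> {0<..<T}"
  proof -
    have "1 / real n > 0" using assms by simp
    then show ?thesis using assms(2) by (auto intro: less_le_trans simp del: zero_less_divide_1_iff)
  qed
  ultimately show ?thesis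
    unfolding test_function_def using sub flat_exp_algebra_smooth[OF time_bump_algebra] by auto
qed

text \<open>The bump vanishes on a neighbourhood of t, even at t = t0, because its support ends at
  t0 - 1 / n. In the weak identity over (0, T) this hides the times after t0, at which nothing is
  known about the state.\<close>

lemma deriv_time_bump_eq_0:
  assumes "n > 0" "t \<ge> t0"
  shows "deriv (time_bump t0 k n) t = 0"
proof -
  have "((\<lambda>_. 0) has_real_derivative 0) (at t)" by simp
  then have "(time_bump t0 k n has_real_derivative 0) (at t)"
  proof (rule has_field_derivative_transform_within_open)
    show "open {t0 - 1 / real n<..}" "t \<in> {t0 - 1 / real n<..}"
      using assms by (auto intro: less_le_trans[of _ t0])
    show "0 = time_bump t0 k n s" if "s \<in> {t0 - 1 / real n<..}" for s
      using time_bump_nonzero[OF assms(1), of t0 k s] that by force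
  qed
  then show ?thesis by (rule DERIV_imp_deriv)
qed

lemma flat_exp_0_bounds: "0 \<le> flat_exp 0 t" "flat_exp 0 t \<le> 1"
  by (auto simp: flat_exp_def)

lemma flat_exp_0_tendsto_1:
  assumes "c > 0"
  shows "(\<lambda>n. flat_exp 0 (real n * c - 1)) \<longlonglongrightarrow> 1"
proof -
  have top: "filterlim (\<lambda>n. real n * c - 1) at_top sequentially"
    using filterlim_tendsto_add_at_top[OF tendsto_const[of "-1"]
        filterlim_at_top_mult_tendsto_pos[OF tendsto_const assms filterlim_real_sequentially]]
    by simp
  have "(\<lambda>n. exp (- inverse (real n * c - 1))) \<longlonglongrightarrow> exp (- 0)"
    by (intro tendsto_exp tendsto_minus tendsto_inverse_0_at_top[OF top]) 
  then have "(\<lambda>n. exp (- inverse (real n * c - 1))) \<longlonglongrightarrow> 1" by simp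
  then show ?thesis
  proof (rule Lim_transform_eventually)
    have "eventually (\<lambda>n. real n * c - 1 > 0) sequentially"
      using top[unfolded filterlim_at_top_dense, rule_format, of 0] .
    then show "eventually (\<lambda>n. exp (- inverse (real n * c - 1)) = flat_exp 0 (real n * c - 1)) sequentially"
      by eventually_elim (simp add: flat_exp_def inverse_eq_divide)
  qed
qed

lemma time_bump_tendsto:
  "(\<lambda>n. time_bump t0 k (Suc n) t) \<longlonglongrightarrow> t ^ k * indicator {0<..<t0} t"
proof (cases "t \<in> {0<..<t0}")
  case True
  have "(\<lambda>n. time_bump t0 k n t) \<longlonglongrightarrow> t ^ k * (1 * 1)"
    unfolding time_bump_def by (intro tendsto_intros flat_exp_0_tendsto_1) (use True in auto)
  then show ?thesis using True by (intro LIMSEQ_Suc) simp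
next
  case False
  have "time_bump t0 k (Suc n) t = 0" for n
  proof (rule ccontr)
    assume "time_bump t0 k (Suc n) t \<noteq> 0"
    from time_bump_nonzero[OF _ this] have "1 / real (Suc n) \<le> t" "t \<le> t0 - 1 / real (Suc n)" by auto
    moreover have "1 / real (Suc n) > 0" by simp
    ultimately have "t > 0" "t < t0" by linarith+
    then show False using False by simp
  qed
  then show ?thesis using False by simp
qed

lemma abs_time_bump_le: "\<bar>time_bump t0 k n t\<bar> \<le> \<bar>t\<bar> ^ k"
proof -
  have "\<bar>flat_exp 0 (real n * t - 1) * flat_exp 0 (real n * (t0 - t) - 1)\<bar> \<le> 1"
    unfolding abs_mult by (intro mult_le_one) (auto simp: flat_exp_0_bounds)
  then have "\<bar>t ^ k\<bar> * \<bar>flat_exp 0 (real n * t - 1) * flat_exp 0 (real n * (t0 - t) - 1)\<bar> \<le> \<bar>t ^ k\<bar>"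
    by (intro mult_left_le) auto
  then show ?thesis by (simp only: time_bump_def abs_mult power_abs)
qed

section \<open>Null sets of products\<close>

lemma AE_lebesgue_iff_negligible: "(AE x in lebesgue. P x) \<longleftrightarrow> negligible {x. \<not> P x}"
  using eventually_ae_filter_negligible negligible_subset by blast

text \<open>Because g is a left inverse of f, the bad points w lie in the g-image of the bad points
  z, and a linear map into a space of at least the same dimension preserves negligible sets. It is
  applied to permutations of coordinates.\<close>

lemma AE_lebesgue_linear_substitution:
  fixes f :: "'b::euclidean_space \<Rightarrow> 'a::euclidean_space" and g :: "'a \<Rightarrow> 'b"
  assumes "DIM('a) \<le> DIM('b)" "linear g" "\<And>w. g (f w) = w"
    and "AE z in lebesgue. P z"
  shows "AE w in lebesgue. P (f w)"
proof -
  have "negligible (g ` {z. \<not> P z})"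
    using assms AE_lebesgue_iff_negligible linear_imp_differentiable_on
    by (intro negligible_differentiable_image_negligible) blast+
  moreover have "{w. \<not> P (f w)} \<subseteq> g ` {z. \<not> P z}"
    using assms(3) by (metis (mono_tags, lifting) imageI mem_Collect_eq subsetI)
  ultimately show ?thesis
    unfolding AE_lebesgue_iff_negligible by (rule negligible_subset)
qed

text \<open>Lebesgue measure on a product is the completion of the product measure, so Fubini is
  applied to \<open>lborel\<close>; completion does not change what holds almost everywhere.\<close>

lemma AE_lebesgue_pair:
  fixes P :: "'a::euclidean_space \<times> 'b::euclidean_space \<Rightarrow> bool"
  assumes "AE z in lebesgue. P z"
  shows "AE x in lebesgue. AE y in lebesgue. P (x, y)"
    and "AE y in lebesgue. AE x in lebesgue. P (x, y)"
proof -
  have *: "AE x in lebesgue. AE y in lebesgue. Q (x, y)" if "AE z in lebesgue. Q z"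
    for Q :: "'c::euclidean_space \<times> 'd::euclidean_space \<Rightarrow> bool"
  proof -
    have "AE z in lborel. Q z" using that by (simp add: AE_completion_iff)
    then have "AE z in lborel \<Otimes>\<^sub>M lborel. Q z" by (simp only: lborel_prod)
    from lborel_pair.AE_pair[OF this] show ?thesis by (simp add: AE_completion_iff)
  qed
  show "AE x in lebesgue. AE y in lebesgue. P (x, y)" by (rule *[OF assms])
  have "linear (\<lambda>z :: 'a \<times> 'b. (snd z, fst z))" by (rule linearI) auto
  from AE_lebesgue_linear_substitution[OF _ this, of prod.swap P] assms
  have "AE w in lebesgue. P (prod.swap w)" by simp
  from *[OF this] show "AE y in lebesgue. AE x in lebesgue. P (x, y)" by simp
qed

text \<open>A nonmeasurable set can have null slices without being null, hence the hypothesis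
  \<open>meas\<close>. The indicator is replaced by a Borel function g that agrees with it almost
  everywhere, and Tonelli is applied to g.\<close>

lemma AE_lebesgue_pairI:
  fixes P :: "'a::euclidean_space \<times> 'b::euclidean_space \<Rightarrow> bool"
  assumes meas: "{z. P z} \<in> sets lebesgue"
    and AE: "(AE x in lebesgue. AE y in lebesgue. P (x, y)) \<or> (AE y in lebesgue. AE x in lebesgue. P (x, y))"
  shows "AE z in lebesgue. P z"
proof -
  have "(indicator {z. P z} :: _ \<Rightarrow> real) \<in> borel_measurable lebesgue"
    using meas by (rule borel_measurable_indicator)
  then obtain g :: "'a \<times> 'b \<Rightarrow> real" where g: "g \<in> borel_measurable lborel"
    "AE z in lborel. indicator {z. P z} z = g z"
    using completion_ex_borel_measurable_real by blast
  have PG: "AE z in lebesgue. P z \<longleftrightarrow> g z = 1"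
    unfolding AE_completion_iff using g(2) by eventually_elim (auto simp: indicator_def split: if_splits)
  have "{z \<in> space lborel. g z = 1} \<in> sets lborel" using g(1) by measurable
  then have Gb: "{z \<in> space (lborel \<Otimes>\<^sub>M lborel). g z = 1} \<in> sets (lborel \<Otimes>\<^sub>M lborel)"
    by (simp only: lborel_prod)
  have "AE x in lborel. AE y in lborel. g (x, y) = 1"
    using AE
  proof
    assume "AE x in lebesgue. AE y in lebesgue. P (x, y)"
    with AE_lebesgue_pair(1)[OF PG] have "AE x in lebesgue. AE y in lebesgue. g (x, y) = 1"
      by eventually_elim (elim AE_mp, auto)
    then show ?thesis by (simp add: AE_completion_iff)
  next
    assume "AE y in lebesgue. AE x in lebesgue. P (x, y)"
    with AE_lebesgue_pair(2)[OF PG] have "AE y in lebesgue. AE x in lebesgue. g (x, y) = 1"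
      by eventually_elim (elim AE_mp, auto)
    then have "AE y in lborel. AE x in lborel. g (x, y) = 1" by (simp add: AE_completion_iff)
    then show ?thesis
      using lborel_pair.AE_commute[of "\<lambda>x y. g (x, y) = 1"] Gb by simp
  qed
  from lborel_pair.AE_pair_measure[OF Gb this]
  have "AE z in lebesgue. g z = 1" by (simp only: AE_completion_iff lborel_prod)
  with PG show ?thesis by eventually_elim simp
qed

text \<open>The exceptional set is enlarged to a Borel null set N, so that the cylinder over it is
  measurable and slicing applies.\<close>

lemma AE_lebesgue_fst:
  fixes Q :: "'a::euclidean_space \<Rightarrow> bool"
  assumes "AE x in lebesgue. Q x"
  shows "AE z in lebesgue. Q (fst (z :: 'a \<times> 'b::euclidean_space))"
proof -
  obtain N where N: "N \<in> null_sets lborel" "{x. \<not> Q x} \<subseteq> N"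
    using assms unfolding AE_completion_iff by (auto elim!: AE_E simp: null_sets_def)
  have [measurable]: "N \<in> sets borel" using N by auto
  have "(- N) \<times> (UNIV :: 'b set) \<in> sets borel" by (intro borel_Times) auto
  also have "(- N) \<times> (UNIV :: 'b set) = {z. fst z \<notin> N}" by auto
  finally have "{z :: 'a \<times> 'b. fst z \<notin> N} \<in> sets lborel" by simp
  then have "{z :: 'a \<times> 'b. fst z \<notin> N} \<in> sets lebesgue"
    by (rule sets_completionI_sets)
  moreover have "AE x in lebesgue. AE y in (lebesgue :: 'b measure). fst (x, y) \<notin> N"
    unfolding AE_completion_iff using AE_not_in[OF N(1)] by eventually_elim simp
  ultimately have "AE z in lebesgue. fst (z :: 'a \<times> 'b) \<notin> N"
    by (intro AE_lebesgue_pairI) auto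
  then show ?thesis by eventually_elim (use N in auto)
qed

section \<open>Vanishing of the weak time derivative\<close>

lemma L2_time_space_measurable:
  assumes "\<Omega> \<in> sets borel" and "L2_time_space T \<Omega> u"
  shows "{0<..<T} \<times> \<Omega> \<in> sets lebesgue"
    and "(\<lambda>z. if z \<in> {0<..<T} \<times> \<Omega> then u (fst z) (snd z) else 0) \<in> borel_measurable lebesgue"
proof -
  show T: "{0<..<T} \<times> \<Omega> \<in> sets lebesgue"
    using assms(1) by (intro sets_completionI_sets) (auto simp: borel_Times)
  show "(\<lambda>z. if z \<in> {0<..<T} \<times> \<Omega> then u (fst z) (snd z) else 0) \<in> borel_measurable lebesgue"
    using assms(2) by (intro borel_measurable_if_I[OF _ T]) (simp add: L2_time_space_def split_def)
qed

text \<open>Supplies the measurability needed by \<open>AE_lebesgue_pairI\<close> for the state and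
  for its time derivative.\<close>

lemma L2_time_space_zero_set:
  fixes \<Omega> :: "'a::euclidean_space set"
  assumes \<Omega>: "\<Omega> \<in> sets borel" and L2: "L2_time_space T \<Omega> u" and "t0 \<le> T"
  shows "{z. z \<in> {0<..<t0} \<times> \<Omega> \<longrightarrow> u (fst z) (snd z) = 0} \<in> sets lebesgue"
proof -
  let ?W = "\<lambda>z. if z \<in> {0<..<T} \<times> \<Omega> then u (fst z) (snd z) else 0"
  have T: "{0<..<t0} \<times> \<Omega> \<in> sets lebesgue"
    using \<Omega> by (intro sets_completionI_sets) (auto simp: borel_Times)
  have "{z \<in> space lebesgue. ?W z = 0} \<in> sets lebesgue"
    using L2_time_space_measurable(2)[OF \<Omega> L2] by measurable
  then have "(- ({0<..<t0} \<times> \<Omega>)) \<union> {z. ?W z = 0} \<in> sets lebesgue"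
    using T by (intro sets.Un) (auto simp: Compl_in_sets_lebesgue)
  also have "(- ({0<..<t0} \<times> \<Omega>)) \<union> {z. ?W z = 0} =
      {z. z \<in> {0<..<t0} \<times> \<Omega> \<longrightarrow> u (fst z) (snd z) = 0}"
    using \<open>t0 \<le> T\<close> by auto
  finally show ?thesis .
qed

text \<open>Tonelli, applied to a Borel representative V, makes almost every slice
  square-integrable; on a bounded interval |V| <= 1 + V^2 turns this into integrability.\<close>

lemma L2_time_space_slice_integrable:
  fixes \<Omega> :: "'a::euclidean_space set"
  assumes \<Omega>: "\<Omega> \<in> sets borel" and L2: "L2_time_space T \<Omega> w"
  shows "AE x in lebesgue. x \<in> \<Omega> \<longrightarrow> integrable (lebesgue_on {0<..<T}) (\<lambda>t. w t x)"
proof -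
  define W where "W z = (if z \<in> {0<..<T} \<times> \<Omega> then w (fst z) (snd z) else 0)" for z
  have "W \<in> borel_measurable lebesgue"
    using L2_time_space_measurable(2)[OF \<Omega> L2] by (simp add: W_def[abs_def])
  then obtain V where V: "V \<in> borel_measurable lborel" "AE z in lborel. W z = V z"
    using completion_ex_borel_measurable_real by blast
  have Vm: "V \<in> borel_measurable (lborel \<Otimes>\<^sub>M lborel)" using V(1) by (simp only: lborel_prod)
  have "(\<integral>\<^sup>+z. ennreal ((V z)\<^sup>2) \<partial>lborel) = (\<integral>\<^sup>+z. ennreal ((W z)\<^sup>2) \<partial>lborel)"
    by (rule nn_integral_cong_AE, use V(2) in eventually_elim) simp
  also have "\<dots> = (\<integral>\<^sup>+z. ennreal ((W z)\<^sup>2) \<partial>lebesgue)"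
    by (simp add: nn_integral_completion)
  also have "\<dots> = (\<integral>\<^sup>+z. ennreal ((w (fst z) (snd z))\<^sup>2) * indicator ({0<..<T} \<times> \<Omega>) z \<partial>lebesgue)"
    by (intro nn_integral_cong) (auto simp: W_def)
  also have "\<dots> = (\<integral>\<^sup>+z. ennreal ((w (fst z) (snd z))\<^sup>2) \<partial>lebesgue_on ({0<..<T} \<times> \<Omega>))"
    using L2_time_space_measurable(1)[OF \<Omega> L2]
    by (subst nn_integral_restrict_space) auto
  also have "\<dots> < \<infinity>" using L2 by (simp add: L2_time_space_def split_def)
  finally have fin: "(\<integral>\<^sup>+x. (\<integral>\<^sup>+t. ennreal ((V (t, x))\<^sup>2) \<partial>lborel) \<partial>lborel) < \<infinity>"
    by (subst lborel_pair.nn_integral_snd) (use Vm in \<open>simp_all add: lborel_prod\<close>)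
  have "(\<lambda>x. \<integral>\<^sup>+t. ennreal ((V (t, x))\<^sup>2) \<partial>lborel) \<in> borel_measurable lborel"
    using Vm by measurable
  from nn_integral_PInf_AE[OF this] fin
  have 1: "AE x in lebesgue. (\<integral>\<^sup>+t. ennreal ((V (t, x))\<^sup>2) \<partial>lborel) \<noteq> \<infinity>"
    by (simp add: AE_completion_iff)
  have "AE z in lebesgue. W z = V z" using V(2) by (simp add: AE_completion_iff)
  from AE_lebesgue_pair(2)[OF this] 1 show ?thesis
  proof eventually_elim
    case (elim x)
    show ?case
    proof
      assume x: "x \<in> \<Omega>"
      have Vx: "(\<lambda>t. V (t, x)) \<in> borel_measurable lborel" using Vm by measurable
      have sq: "integrable lborel (\<lambda>t. (V (t, x))\<^sup>2)"
        using elim(2) Vx by (intro integrableI_bounded) (auto simp: less_top)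
      have ae: "AE t in lborel. W (t, x) = V (t, x)" using elim(1) by (simp add: AE_completion_iff)
      have "integrable lborel (\<lambda>t. V (t, x))"
      proof (rule Bochner_Integration.integrable_bound)
        show "integrable lborel (\<lambda>t. indicator {0<..<T} t + (V (t, x))\<^sup>2)"
          by (intro Bochner_Integration.integrable_add sq integrable_real_indicator)
            (use emeasure_lborel_box_finite[of 0 T] in auto)
        show "(\<lambda>t. V (t, x)) \<in> borel_measurable lborel" by (rule Vx)
        show "AE t in lborel. norm (V (t, x)) \<le> norm (indicator {0<..<T} t + (V (t, x))\<^sup>2 :: real)"
          using ae
        proof eventually_elim
          case (elim t)
          have "\<bar>V (t, x)\<bar> \<le> 1 + (V (t, x))\<^sup>2"
            using zero_le_power2[of "\<bar>V (t, x)\<bar> - 1"] by (simp add: power2_eq_square algebra_simps)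
          then show ?case using elim by (cases "t \<in> {0<..<T}") (auto simp: W_def)
        qed
      qed
      then have "integrable lebesgue (\<lambda>t. V (t, x))"
        using Vx by (simp add: integrable_completion)
      then have "(\<lambda>t. V (t, x)) absolutely_integrable_on UNIV"
        by (simp add: set_integrable_def)
      then have "(\<lambda>t. W (t, x)) absolutely_integrable_on UNIV"
        by (rule absolutely_integrable_spike[where S = "{t. W (t, x) \<noteq> V (t, x)}"])
          (use elim(1) in \<open>auto simp: AE_lebesgue_iff_negligible\<close>)
      then have "integrable lebesgue (\<lambda>t. W (t, x))"
        by (simp add: set_integrable_def)
      also have "(\<lambda>t. W (t, x)) = (\<lambda>t. indicator {0<..<T} t *\<^sub>R w t x)"
        using x by (auto simp: W_def fun_eq_iff)
      finally show "integrable (lebesgue_on {0<..<T}) (\<lambda>t. w t x)"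
        by (subst integrable_restrict_space) auto
    qed
  qed
qed

text \<open>Letting n tend to infinity turns orthogonality to the bumps into vanishing of all
  moments of h on (0, t0); polynomials are dense. The bound |t|^k on the bumps gives the
  majorant.\<close>

lemma AE_zero_if_orthogonal_time_bumps:
  fixes h :: "real \<Rightarrow> real"
  assumes h: "integrable (lebesgue_on {0<..<T}) h" and t0: "t0 \<le> T"
    and orth: "\<And>k n. (LINT t:{0<..<T}|lebesgue. h t * time_bump t0 k (Suc n) t) = 0"
  shows "AE t in lebesgue. t \<in> {0<..<t0} \<longrightarrow> h t = 0"
proof -
  \<comment> \<open>The cut-off to the open interval is built into v, so that the moments can be
    taken over the compact interval that Weierstrass requires.\<close>
  define v where "v t = indicator {0<..<t0} t * h t" for t :: real
  have hi: "integrable lebesgue (\<lambda>t. indicator {0<..<T} t *\<^sub>R h t)"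
    using h by (subst (asm) integrable_restrict_space) auto
  have "integrable lebesgue (\<lambda>t. indicator {0<..<t0} t *\<^sub>R (indicator {0<..<T} t *\<^sub>R h t))"
    by (rule integrable_mult_indicator[OF _ hi]) auto
  also have "(\<lambda>t. indicator {0<..<t0} t *\<^sub>R (indicator {0<..<T} t *\<^sub>R h t)) = v"
    using t0 by (auto simp: v_def indicator_def fun_eq_iff)
  finally have vi: "integrable lebesgue v" .
  have vK: "integrable (lebesgue_on {0..t0}) v"
    using integrable_mult_indicator[OF _ vi, of "{0..t0}"] by (subst integrable_restrict_space) auto
  have mom: "(\<integral>t. v t * t ^ k \<partial>lebesgue_on {0..t0}) = 0" for k
  proof -
    have "(\<lambda>n. \<integral>t. indicator {0<..<T} t *\<^sub>R (h t * time_bump t0 k (Suc n) t) \<partial>lebesgue)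
      \<longlonglongrightarrow> (\<integral>t. v t * t ^ k \<partial>lebesgue)"
    proof (rule integral_dominated_convergence)
      show "integrable lebesgue (\<lambda>t. \<bar>T\<bar> ^ k * \<bar>indicator {0<..<T} t *\<^sub>R h t\<bar>)"
        using hi by auto
      have pm: "p \<in> borel_measurable lebesgue" if "continuous_on UNIV p" for p :: "real \<Rightarrow> real"
        using continuous_imp_measurable_on_sets_lebesgue[OF that] by (simp add: lebesgue_on_UNIV_eq)
      have "(\<lambda>t :: real. t ^ k) \<in> borel_measurable lebesgue" by (intro pm continuous_intros)
      then show "(\<lambda>t. v t * t ^ k) \<in> borel_measurable lebesgue"
        using vi by measurable
      fix n
      have "Ck_on 0 UNIV (time_bump t0 k (Suc n))"
        using flat_exp_algebra_smooth[OF time_bump_algebra] unfolding smooth_on_def by blast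
      then have "time_bump t0 k (Suc n) \<in> borel_measurable lebesgue" by (intro pm) simp
      then have "(\<lambda>t. (indicator {0<..<T} t *\<^sub>R h t) * time_bump t0 k (Suc n) t) \<in> borel_measurable lebesgue"
        using hi by measurable
      then show "(\<lambda>t. indicator {0<..<T} t *\<^sub>R (h t * time_bump t0 k (Suc n) t)) \<in> borel_measurable lebesgue"
        by (simp add: mult.assoc)
      show "AE t in lebesgue. norm (indicator {0<..<T} t *\<^sub>R (h t * time_bump t0 k (Suc n) t))
          \<le> \<bar>T\<bar> ^ k * \<bar>indicator {0<..<T} t *\<^sub>R h t\<bar>"
      proof (rule AE_I2)
        fix t
        show "norm (indicator {0<..<T} t *\<^sub>R (h t * time_bump t0 k (Suc n) t))
          \<le> \<bar>T\<bar> ^ k * \<bar>indicator {0<..<T} t *\<^sub>R h t\<bar>"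
        proof (cases "t \<in> {0<..<T}")
          case True
          have "\<bar>time_bump t0 k (Suc n) t\<bar> \<le> \<bar>T\<bar> ^ k"
            by (rule order_trans[OF abs_time_bump_le power_mono]) (use True in auto)
          then have "\<bar>h t\<bar> * \<bar>time_bump t0 k (Suc n) t\<bar> \<le> \<bar>h t\<bar> * \<bar>T\<bar> ^ k"
            by (intro mult_left_mono) auto
          then show ?thesis using True by (simp add: abs_mult mult.commute)
        qed simp
      qed
    next
      have "(\<lambda>n. indicator {0<..<T} t *\<^sub>R (h t * time_bump t0 k (Suc n) t)) \<longlonglongrightarrow>
         indicator {0<..<T} t *\<^sub>R (h t * (t ^ k * indicator {0<..<t0} t))" for t
        by (intro tendsto_intros time_bump_tendsto)
      moreover have "indicator {0<..<T} t *\<^sub>R (h t * (t ^ k * indicator {0<..<t0} t)) = v t * t ^ k" for t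
        using t0 by (auto simp: v_def indicator_def)
      ultimately show "AE t in lebesgue. (\<lambda>n. indicator {0<..<T} t *\<^sub>R (h t * time_bump t0 k (Suc n) t))
         \<longlonglongrightarrow> v t * t ^ k" by (intro AE_I2) metis
    qed
    then have "(\<integral>t. v t * t ^ k \<partial>lebesgue) = 0"
      using orth[of k] by (simp add: set_lebesgue_integral_def LIMSEQ_const_iff)
    also have "(\<integral>t. v t * t ^ k \<partial>lebesgue) = (\<integral>t. indicator {0..t0} t *\<^sub>R (v t * t ^ k) \<partial>lebesgue)"
      by (intro Bochner_Integration.integral_cong) (auto simp: v_def indicator_def)
    also have "\<dots> = (\<integral>t. v t * t ^ k \<partial>lebesgue_on {0..t0})"
      by (subst integral_restrict_space) auto
    finally show ?thesis .
  qed
  have "AE t in lebesgue_on {0..t0}. v t = 0"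
  proof (rule AE_zero_if_orthogonal_continuous[OF compact_Icc vK])
    fix g :: "real \<Rightarrow> real" assume g: "continuous_on {0..t0} g"
    show "(\<integral>t. v t * g t \<partial>lebesgue_on {0..t0}) = 0"
    proof (rule integral_zero_uniform_closure[OF compact_Icc vK g])
      fix e :: real assume "e > 0"
      obtain p where p: "real_polynomial_function p" "\<And>t. t \<in> {0..t0} \<Longrightarrow> \<bar>g t - p t\<bar> < e"
        using Stone_Weierstrass_real_polynomial_function[OF compact_Icc g \<open>e > 0\<close>] by blast
      obtain a n where pn: "p = (\<lambda>t. \<Sum>i\<le>n. a i * t ^ i)"
        using p(1) real_polynomial_function_iff_sum by blast
      have "(\<integral>t. v t * p t \<partial>lebesgue_on {0..t0}) =
          (\<integral>t. (\<Sum>i\<le>n. a i * (v t * t ^ i)) \<partial>lebesgue_on {0..t0})"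
        by (simp add: pn sum_distrib_left mult.left_commute)
      also have "\<dots> = (\<Sum>i\<le>n. \<integral>t. a i * (v t * t ^ i) \<partial>lebesgue_on {0..t0})"
        by (intro Bochner_Integration.integral_sum integrable_mult_right
            integrable_mult_continuous_lebesgue_on[OF compact_Icc vK] continuous_intros)
      also have "\<dots> = 0" by (simp add: mom)
      finally show "\<exists>h. continuous_on {0..t0} h \<and> (\<integral>t. v t * h t \<partial>lebesgue_on {0..t0}) = 0 \<and>
          (\<forall>t\<in>{0..t0}. \<bar>g t - h t\<bar> < e)"
        using p(2) by (intro exI[of _ p]) (auto simp: pn intro!: continuous_intros)
    qed
  qed
  then have "AE t in lebesgue. t \<in> {0..t0} \<longrightarrow> v t = 0"
    by (subst (asm) AE_restrict_space_iff) auto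
  then show ?thesis by eventually_elim (auto simp: v_def)
qed

text \<open>Tested with a bump, the side of the weak identity containing \<open>u\<close> vanishes:
  \<open>u\<close> is 0 before t0 and the derivative of the bump is 0 from t0 on.\<close>

lemma weak_time_derivative_zero:
  fixes \<Omega> :: "'a::euclidean_space set"
  assumes \<Omega>: "\<Omega> \<in> sets borel" and L2: "L2_time_space T \<Omega> w"
    and weak: "has_weak_time_derivative T \<Omega> u w" and t0: "t0 \<le> T"
    and zero: "AE x in lebesgue. x \<in> \<Omega> \<longrightarrow> (AE t in lebesgue. t \<in> {0<..<t0} \<longrightarrow> u t x = 0)"
  shows "AE x in lebesgue. x \<in> \<Omega> \<longrightarrow> (AE t in lebesgue. t \<in> {0<..<t0} \<longrightarrow> w t x = 0)"
proof -
  have "AE x in lebesgue. x \<in> \<Omega> \<longrightarrow> (LINT t:{0<..<T}|lebesgue. w t x * time_bump t0 k (Suc n) t) = 0" for k n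
  proof -
    have "AE x in lebesgue. x \<in> \<Omega> \<longrightarrow>
           (LINT t:{0<..<T}|lebesgue. u t x * deriv (time_bump t0 k (Suc n)) t) =
           - (LINT t:{0<..<T}|lebesgue. w t x * time_bump t0 k (Suc n) t)"
      using weak test_function_time_bump[of "Suc n" t0 T k] t0
      by (simp add: has_weak_time_derivative_def)
    with zero show ?thesis
    proof eventually_elim
      case (elim x)
      show ?case
      proof
        assume x: "x \<in> \<Omega>"
        have "AE t in lebesgue. indicator {0<..<T} t *\<^sub>R (u t x * deriv (time_bump t0 k (Suc n)) t) = 0"
          using elim(1)[rule_format, OF x]
        proof eventually_elim
          case (elim t)
          then show ?case using deriv_time_bump_eq_0[of "Suc n" t0 t k]
            by (cases "t < t0") (auto simp: indicator_def)
        qed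
        then have "(LINT t:{0<..<T}|lebesgue. u t x * deriv (time_bump t0 k (Suc n)) t) = 0"
          unfolding set_lebesgue_integral_def by (rule integral_eq_zero_AE)
        then show "(LINT t:{0<..<T}|lebesgue. w t x * time_bump t0 k (Suc n) t) = 0"
          using elim(2) x by simp
      qed
    qed
  qed
  \<comment> \<open>The exceptional set of x depends on k and n; there are only countably many of
    them, so one null set serves all bumps.\<close>
  then have "AE x in lebesgue. \<forall>k n. x \<in> \<Omega> \<longrightarrow>
      (LINT t:{0<..<T}|lebesgue. w t x * time_bump t0 k (Suc n) t) = 0"
    unfolding AE_all_countable by blast
  with L2_time_space_slice_integrable[OF \<Omega> L2] show ?thesis
    by eventually_elim (use AE_zero_if_orthogonal_time_bumps[OF _ t0] in blast)
qed

section \<open>Vanishing of the state and of the source\<close>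

text \<open>At an exterior point x with \<open>v x = 0\<close> the difference quotient is v (y)
  times a power of the distance, so the Neumann condition becomes the vanishing of a Riesz potential
  at x.\<close>

lemma AE_zero_if_exterior_neumann:
  fixes v :: "'a::euclidean_space \<Rightarrow> real"
  assumes \<beta>: "0 < \<beta>" and v: "integrable lebesgue v" and \<Omega>: "bounded \<Omega>"
    and out: "AE x in lebesgue. x \<notin> \<Omega> \<longrightarrow> v x = 0"
    and neu: "AE x in lebesgue. x \<notin> \<Omega> \<longrightarrow> has_NDstar \<beta> v x 0"
  shows "AE x in lebesgue. v x = 0"
proof -
  define s where "s = real DIM('a) + 2 * \<beta>"
  have s: "s > 0" unfolding s_def using \<beta> by (intro add_nonneg_pos) auto
  obtain R where R: "R > 0" "\<And>x. x \<in> \<Omega> \<Longrightarrow> norm x \<le> R"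
    using \<Omega> unfolding bounded_pos by blast
  define K where "K = cball (0::'a) R"
  have K: "compact K" by (simp add: K_def)
  have \<Omega>K: "\<Omega> \<subseteq> K" using R by (auto simp: K_def)
  obtain e :: 'a where e: "norm e = 1" using vector_choose_size[of 1] by auto
  \<comment> \<open>With the centre at distance R + 2 and radius 1, every point of \<open>U\<close>
    is more than 1 away from \<open>K\<close>.\<close>
  define U where "U = ball ((R + 2) *\<^sub>R e) 1"
  have far: "dist x y > 1" if "x \<in> U" "y \<in> K" for x y
  proof -
    have "norm ((R + 2) *\<^sub>R e) = R + 2" using R e by simp
    moreover have tri: "norm c \<le> dist c x + dist x y + norm y" for c
      by norm
    have "dist ((R + 2) *\<^sub>R e) x < 1" "norm y \<le> R" using that by (auto simp: U_def K_def)
    ultimately show ?thesis using tri[of "(R + 2) *\<^sub>R e"] by linarith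
  qed
  have disj: "U \<inter> K = {}" using far by fastforce
  have vK: "integrable (lebesgue_on K) v"
    using integrable_mult_indicator[OF _ v, of K] K
    by (subst integrable_restrict_space) (auto simp: K_def)
  have "AE x in lebesgue. x \<in> U \<longrightarrow>
       (\<integral>y. v y * ((y - x) \<bullet> (y - x)) powr (- (s / 2)) \<partial>lebesgue_on K) = 0"
    using out neu
  proof eventually_elim
    case (elim x)
    show ?case
    proof
      assume x: "x \<in> U"
      then have "x \<notin> \<Omega>" using disj \<Omega>K by auto
      then have vx: "v x = 0" and pv: "has_pv_integral (nl_quotient \<beta> v x) x 0"
        using elim by (auto simp: has_NDstar_def)
      let ?k = "\<lambda>y. v y * ((y - x) \<bullet> (y - x)) powr (- (s / 2))"
      have kc: "continuous_on K (\<lambda>y. ((y - x) \<bullet> (y - x)) powr (- (s / 2)))"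
        using x disj by (intro continuous_intros) auto
      have ki: "integrable lebesgue (\<lambda>y. indicator K y *\<^sub>R ?k y)"
        using integrable_mult_continuous_lebesgue_on[OF K vK kc] K
        by (subst (asm) integrable_restrict_space) (auto simp: K_def)
      \<comment> \<open>For r < 1 the excised ball misses \<open>K\<close>, and off \<open>K\<close>
        the density vanishes almost everywhere, so the truncated integrals do not depend on r. The
        exponent s is halved because the inner product is the squared distance.\<close>
      have eq: "(LINT y:- ball x r|lebesgue. nl_quotient \<beta> v x y) = (\<integral>y. ?k y \<partial>lebesgue_on K)"
        if r: "0 < r" "r < 1" for r
      proof -
        have qi: "integrable lebesgue (\<lambda>y. indicator (- ball x r) y *\<^sub>R nl_quotient \<beta> v x y)"
          using pv r by (simp add: has_pv_integral_def set_integrable_def)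
        have "AE y in lebesgue. indicator (- ball x r) y *\<^sub>R nl_quotient \<beta> v x y = indicator K y *\<^sub>R ?k y"
          using out
        proof eventually_elim
          case (elim y)
          show ?case
          proof (cases "y \<in> K")
            case True
            then have "dist x y > 1" using far x by blast
            then have "y \<notin> ball x r" "norm (y - x) > 0" using r by (auto simp: dist_norm norm_minus_commute)
            then have "((y - x) \<bullet> (y - x)) powr (- (s / 2)) = 1 / norm (y - x) powr s"
              by (simp add: dot_square_norm powr_powr powr_minus_divide flip: powr_numeral)
            then show ?thesis using True \<open>y \<notin> ball x r\<close> vx
              by (simp add: nl_quotient_def s_def)
          next
            case False
            then have "v y = 0" using elim \<Omega>K by blast
            then show ?thesis using False vx by (simp add: nl_quotient_def)
          qed
        qed
        then have "(LINT y:- ball x r|lebesgue. nl_quotient \<beta> v x y) =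
            (\<integral>y. indicator K y *\<^sub>R ?k y \<partial>lebesgue)"
          unfolding set_lebesgue_integral_def using qi ki by (intro integral_cong_AE) auto
        also have "\<dots> = (\<integral>y. ?k y \<partial>lebesgue_on K)"
          by (subst integral_restrict_space) (auto simp: K_def)
        finally show ?thesis .
      qed
      have "((\<lambda>r. LINT y:- ball x r|lebesgue. nl_quotient \<beta> v x y) \<longlongrightarrow> (\<integral>y. ?k y \<partial>lebesgue_on K)) (at_right 0)"
        by (rule Lim_transform_eventually[OF tendsto_const])
          (auto simp: eventually_at_right_field eq intro!: exI[of _ 1])
      moreover have "((\<lambda>r. LINT y:- ball x r|lebesgue. nl_quotient \<beta> v x y) \<longlongrightarrow> 0) (at_right 0)"
        using pv by (simp add: has_pv_integral_def)
      ultimately show "(\<integral>y. ?k y \<partial>lebesgue_on K) = 0"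
        by (rule tendsto_unique[OF trivial_limit_at_right_real])
    qed
  qed
  then have "AE y in lebesgue_on K. v y = 0"
    by (rule riesz_potential_unique_continuation[OF K vK _ _ _ disj, rotated -1])
      (use s \<beta> in \<open>auto simp: U_def s_def field_simps\<close>)
  then have "AE y in lebesgue. y \<in> K \<longrightarrow> v y = 0"
    by (subst (asm) AE_restrict_space_iff) (auto simp: K_def)
  with out show ?thesis by eventually_elim (use \<Omega>K in auto)
qed

text \<open>The value at x is required separately because it enters the quotient for every y. All
  truncated integrals are then 0, and so is their limit.\<close>

lemma has_DDstar_AE_zero:
  fixes v :: "'a::euclidean_space \<Rightarrow> real"
  assumes q: "has_DDstar \<beta> v x q" and "v x = 0" and "AE y in lebesgue. v y = 0"
  shows "q = 0"
proof -
  obtain I where I: "((\<lambda>e. LINT y:- ball x e|lebesgue. nl_quotient \<beta> v x y) \<longlongrightarrow> I) (at_right 0)"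
    "q = - 2 * I"
    using q by (auto simp: has_DDstar_def has_pv_integral_def)
  have "(LINT y:- ball x e|lebesgue. nl_quotient \<beta> v x y) = 0" for e
    unfolding set_lebesgue_integral_def
    by (rule integral_eq_zero_AE, use assms(3) in eventually_elim) (simp add: nl_quotient_def assms(2))
  then have "I = 0" using I(1) by (simp add: tendsto_const_iff)
  then show ?thesis using I(2) by simp
qed

text \<open>The first space coordinate is moved to the front; for almost every value of it the
  statement holds for almost every remaining pair, and one such value in the interval is enough
  because \<open>P\<close> does not see it.\<close>

lemma AE_lebesgue_drop_coordinate:
  fixes P :: "real \<Rightarrow> 'b::euclidean_space \<Rightarrow> bool"
  assumes "AE (t, x) in lebesgue. t \<in> A \<and> fst x \<in> {a<..<b} \<longrightarrow> P t (snd x)" and "a < (b::real)"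
  shows "AE (t, x') in lebesgue. t \<in> A \<longrightarrow> P t x'"
proof -
  have lin: "linear (\<lambda>z :: real \<times> (real \<times> 'b). (fst (snd z), (fst z, snd (snd z))))"
    by (rule linearI) auto
  have "AE w in lebesgue. case (fst (snd w), (fst w, snd (snd w))) of
     (t, x) \<Rightarrow> t \<in> A \<and> fst x \<in> {a<..<b} \<longrightarrow> P t (snd x)"
    by (rule AE_lebesgue_linear_substitution[OF _ lin _ assms(1)]) auto
  from AE_lebesgue_pair(1)[OF this]
  have "AE x1 in lebesgue. AE (t, x') in lebesgue. t \<in> A \<and> x1 \<in> {a<..<b} \<longrightarrow> P t x'"
    by (simp add: split_def)
  then obtain x1 where "x1 \<in> {a<..<b}"
    "AE (t, x') in lebesgue. t \<in> A \<and> x1 \<in> {a<..<b} \<longrightarrow> P t x'"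
    by (rule AE_lebesgue_open_witness[of _ "{a<..<b}"]) (use assms(2) in auto)
  then show ?thesis by simp
qed

lemma continuous_AE_zero_imp_zero:
  fixes f :: "real \<Rightarrow> 'b::euclidean_space \<Rightarrow> real"
  assumes cont: "continuous_on ({0..t0} \<times> D) (\<lambda>(t, x). f t x)" and "0 < t0" and D: "open D"
    and AE: "AE (t, x) in lebesgue. t \<in> {0..t0} \<and> x \<in> D \<longrightarrow> f t x = 0"
    and t: "t \<in> {0..t0}" and x: "x \<in> D"
  shows "f t x = 0"
proof (rule ccontr)
  assume ne: "f t x \<noteq> 0"
  obtain d where d: "d > 0" "\<And>s y. s \<in> {0..t0} \<Longrightarrow> y \<in> D \<Longrightarrow> dist (s, y) (t, x) < d \<Longrightarrow>
      dist (f s y) (f t x) < \<bar>f t x\<bar>"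
    using cont[unfolded continuous_on_iff, rule_format, of "(t, x)" "\<bar>f t x\<bar>"] t x ne by force
  \<comment> \<open>The time t may be an endpoint; interior times near it are needed to obtain an
    open set in the whole space.\<close>
  have "t \<in> closure {0<..<t0}" using t \<open>0 < t0\<close> by (simp add: closure_greaterThanLessThan)
  then obtain s where s: "s \<in> {0<..<t0}" "dist s t < d"
    using d(1) closure_approachable by blast
  let ?S = "ball (t, x) d \<inter> ({0<..<t0} \<times> D)"
  have "open ?S" using D by (intro open_Int open_Times) auto
  moreover have "(s, x) \<in> ?S" using s x by (auto simp: dist_Pair_Pair dist_commute)
  ultimately obtain z where "z \<in> ?S" "case z of (t, x) \<Rightarrow> t \<in> {0..t0} \<and> x \<in> D \<longrightarrow> f t x = 0"
    using AE_lebesgue_open_witness[OF AE, of ?S] by blast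
  then show False using d(2)[of "fst z" "snd z"] by (auto simp: dist_commute)
qed

text \<open>Fubini fixes almost every time, at which the exterior argument applies to the single
  state \<open>u t\<close>; \<open>Hbc\<close> supplies its integrability.\<close>

lemma state_AE_zero:
  fixes u :: "real \<Rightarrow> 'a::euclidean_space \<Rightarrow> real"
  assumes "0 < \<beta>" and C: "C_Hbc \<beta> T u" and \<Omega>: "bounded \<Omega>" and "t0 \<le> T"
    and neu: "AE (t, x) in lebesgue. t \<in> {0<..<T} \<and> x \<notin> \<Omega> \<longrightarrow> has_NDstar \<beta> (u t) x 0"
    and out: "AE (t, x) in lebesgue. t \<in> {0<..<t0} \<and> x \<notin> \<Omega> \<longrightarrow> u t x = 0"
  shows "AE t in lebesgue. t \<in> {0<..<t0} \<longrightarrow> (AE x in lebesgue. u t x = 0)"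
  using AE_lebesgue_pair(1)[OF neu] AE_lebesgue_pair(1)[OF out]
proof eventually_elim
  case (elim t)
  show ?case
  proof
    assume t: "t \<in> {0<..<t0}"
    then have "u t \<in> Hbc \<beta>"
      using C \<open>t0 \<le> T\<close> by (auto simp: C_Hbc_def)
    then have "integrable lebesgue (u t)"
      by (auto simp: Hbc_def has_bochner_integral_iff)
    then show "AE x in lebesgue. u t x = 0"
      by (rule AE_zero_if_exterior_neumann[OF \<open>0 < \<beta>\<close> _ \<Omega>])
        (use elim t \<open>t0 \<le> T\<close> in auto)
  qed
qed

text \<open>The state vanishes for almost every t first and x second, while the weak derivative
  needs x first. Each exchange passes through a joint statement on the product, both for
  \<open>u\<close> and for \<open>ut\<close>.\<close>

lemma source_AE_zero:
  fixes u ut F :: "real \<Rightarrow> 'a::euclidean_space \<Rightarrow> real"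
  assumes \<Omega>: "\<Omega> \<in> sets borel" and "t0 \<le> T"
    and uL2: "L2_time_space T \<Omega> u" and utL2: "L2_time_space T \<Omega> ut"
    and weak: "has_weak_time_derivative T \<Omega> u ut"
    and eqn: "AE (t, x) in lebesgue. t \<in> {0<..<T} \<and> x \<in> \<Omega> \<longrightarrow>
           (\<exists>q. has_DDstar \<beta> (u t) x q \<and> ut t x + q = F t x)"
    and u0: "AE t in lebesgue. t \<in> {0<..<t0} \<longrightarrow> (AE x in lebesgue. u t x = 0)"
  shows "AE (t, x) in lebesgue. t \<in> {0<..<t0} \<and> x \<in> \<Omega> \<longrightarrow> F t x = 0"
proof -
  have "AE t in lebesgue. AE x in lebesgue. (t, x) \<in> {0<..<t0} \<times> \<Omega> \<longrightarrow> u (fst (t, x)) (snd (t, x)) = 0"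
    using u0 by eventually_elim auto
  then have uz: "AE z in lebesgue. z \<in> {0<..<t0} \<times> \<Omega> \<longrightarrow> u (fst z) (snd z) = 0"
    using AE_lebesgue_pairI[OF L2_time_space_zero_set[OF \<Omega> uL2 \<open>t0 \<le> T\<close>]] by simp
  have "AE x in lebesgue. x \<in> \<Omega> \<longrightarrow> (AE t in lebesgue. t \<in> {0<..<t0} \<longrightarrow> u t x = 0)"
    using AE_lebesgue_pair(2)[OF uz] by eventually_elim auto
  from weak_time_derivative_zero[OF \<Omega> utL2 weak \<open>t0 \<le> T\<close> this]
  have "AE x in lebesgue. AE t in lebesgue. (t, x) \<in> {0<..<t0} \<times> \<Omega> \<longrightarrow> ut (fst (t, x)) (snd (t, x)) = 0"
    by eventually_elim auto
  then have utz: "AE z in lebesgue. z \<in> {0<..<t0} \<times> \<Omega> \<longrightarrow> ut (fst z) (snd z) = 0"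
    using AE_lebesgue_pairI[OF L2_time_space_zero_set[OF \<Omega> utL2 \<open>t0 \<le> T\<close>]] by simp
  have point: "F t x = 0"
    if "has_DDstar \<beta> (u t) x q" "ut t x + q = F t x" "u t x = 0" "ut t x = 0" "AE y in lebesgue. u t y = 0"
    for t x q
    using has_DDstar_AE_zero[OF that(1,3,5)] that(2,4) by simp
  show ?thesis
    \<comment> \<open>At almost every (t, x) the equation, the two pointwise zeros and the vanishing
      of the whole state at time t hold together, so the nonlocal term is 0 as well.\<close>
    using eqn uz utz AE_lebesgue_fst[OF u0]
    by eventually_elim (use \<open>t0 \<le> T\<close> point in fastforce)
qed

text \<open>The equation is imposed almost everywhere and so determines the source only up to a null
  set; pointwise vanishing is concluded for a continuous source.\<close>

theorem theorem4p2:
  fixes l T t0 \<beta> :: real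
    and D' :: "(real ^ 'm) set"
    and \<Omega> :: "(real \<times> (real ^ 'm)) set"
    and u ut u1 :: "real \<Rightarrow> real \<times> (real ^ 'm) \<Rightarrow> real"
    and f :: "real \<Rightarrow> real ^ 'm \<Rightarrow> real"
  assumes "0 < l" and "smooth_bounded_domain D'" and "\<Omega> = {0<..<l} \<times> D'"
    and "0 < \<beta>" and "\<beta> < 1"
    and "C_Hbc \<beta> T u" and "H1_L2 T \<Omega> u"
    and "L2_time_space T \<Omega> ut" and "has_weak_time_derivative T \<Omega> u ut"
    and "\<And>t. t \<in> {0..T} \<Longrightarrow> has_weak_derivative_along (1, 0) (u t) (u1 t)"
    and "C_Hbc \<beta> T u1" and "H1_L2 T \<Omega> u1"
    and "AE (t, x) in lebesgue. t \<in> {0<..<T} \<and> x \<in> \<Omega> \<longrightarrow>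
           (\<exists>q. has_DDstar \<beta> (u t) x q \<and> ut t x + q = f t (snd x))"
    and "AE x in lebesgue. u 0 x = 0"
    and "AE (t, x) in lebesgue. t \<in> {0<..<T} \<and> x \<notin> \<Omega> \<longrightarrow> has_NDstar \<beta> (u t) x 0"
    and "0 < t0" and "t0 \<le> T"
    and "AE (t, x) in lebesgue. t \<in> {0<..<t0} \<and> x \<notin> \<Omega> \<longrightarrow> u t x = 0"
  shows "(AE (t, x') in lebesgue. t \<in> {0..t0} \<and> x' \<in> D' \<longrightarrow> f t x' = 0) \<and>
         (continuous_on ({0..t0} \<times> D') (\<lambda>(t, x'). f t x') \<longrightarrow>
            (\<forall>t\<in>{0..t0}. \<forall>x'\<in>D'. f t x' = 0))"
proof -
  have D': "open D'" "bounded D'" using assms(2) by (auto simp: smooth_bounded_domain_def)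
  have "\<Omega> \<in> sets borel"
    unfolding assms(3) using D'(1) by (intro borel_open open_Times) auto
  moreover have "bounded \<Omega>"
    unfolding assms(3) using D'(2) by (intro bounded_Times) auto
  moreover have "L2_time_space T \<Omega> u" using assms(7) by (simp add: H1_L2_def)
  ultimately have "AE (t, x) in lebesgue. t \<in> {0<..<t0} \<and> x \<in> \<Omega> \<longrightarrow> f t (snd x) = 0"
    using assms(17,8,9,13) state_AE_zero[OF assms(4,6) _ assms(17,15,18)]
    by (intro source_AE_zero)
  then have "AE (t, x) in lebesgue. t \<in> {0<..<t0} \<and> fst x \<in> {0<..<l} \<longrightarrow> snd x \<in> D' \<longrightarrow> f t (snd x) = 0"
    by eventually_elim (auto simp: assms(3))
  from AE_lebesgue_drop_coordinate[OF this assms(1)]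
  have open_AE: "AE (t, x') in lebesgue. t \<in> {0<..<t0} \<longrightarrow> x' \<in> D' \<longrightarrow> f t x' = 0" .
  \<comment> \<open>The two end times form a null set, which extends the result to the closed
    interval.\<close>
  have "AE t in lebesgue. t \<noteq> 0 \<and> t \<noteq> t0"
    unfolding AE_lebesgue_iff_negligible
    by (rule negligible_subset[of "{0, t0}"]) auto
  then have "AE z in lebesgue. fst (z :: real \<times> (real ^ 'm)) \<noteq> 0 \<and> fst z \<noteq> t0"
    by (rule AE_lebesgue_fst)
  with open_AE have AE: "AE (t, x') in lebesgue. t \<in> {0..t0} \<and> x' \<in> D' \<longrightarrow> f t x' = 0"
    by eventually_elim auto
  have "f t x' = 0"
    if "continuous_on ({0..t0} \<times> D') (\<lambda>(t, x'). f t x')" "t \<in> {0..t0}" "x' \<in> D'" for t x'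
    by (rule continuous_AE_zero_imp_zero[OF that(1) assms(16) D'(1) AE that(2,3)])
  with AE show ?thesis by (intro conjI impI ballI)
qed

end
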